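(* Let $Q\in\mathbb{R}^{d\times d}$ be symmetric positive definite with eigenvalue decomposition $Q=U\Lambda U^\top$, $U$ orthogonal, $\Lambda=\mathrm{diag}(\lambda_1,\dots,\lambda_d)$, $\lambda_1\le\dots\le\lambda_d$, let $\alpha>0$, $\beta,\nu\ge0$ be such that $\rho(A_Q)<1$, and let $\theta>0$ satisfy $\sqrt\theta H_\infty<\sqrt d$. Consider, for $\gamma=\frac1{\sqrt{\theta/d}}$, the $2d\times2d$ discrete-time algebraic Riccati equation $$X=A_Q^\top XA_Q+A_Q^\top XB(\gamma^2\mathsf I_d-B^\top XB)^{-1}B^\top XA_Q+T^\top T.$$ Then its stabilizing solution $\overline X\in\mathbb{R}^{2d\times2d}$ (a symmetric solution with $\rho(A_Q+\gamma^{-2}BB^\top\overline X)<1$) is unique and is given by $$\overline X=Y\,\mathrm{Diag}\big(\tilde X^{(\lambda_1)},\dots,\tilde X^{(\lambda_d)}\big)\,Y^\top,$$ where $\tilde X^{(\lambda_i)}\in\mathbb{R}^{2\times2}$ is the stabilizing solution for $\lambda=\lambda_i$ and $\gamma=\frac1{\sqrt{\theta/d}}$ of $$\tilde X=(\tilde A^{(\lambda)})^\top\tilde X\tilde A^{(\lambda)}+(\tilde A^{(\lambda)})^\top\tilde X\tilde B(\gamma^2-\tilde B^\top\tilde X\tilde B)^{-1}\tilde B^\top\tilde X\tilde A^{(\lambda)}+\begin{bmatrix}\frac\lambda2&0\\0&0\end{bmatrix},$$ and $Y=V\Sigma\in\mathbb{R}^{2d\times2d}$ is an orthonormal matrix with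 $V=\mathrm{Diag}(U,U)$ and $\Sigma\in\mathbb{R}^{2d\times2d}$ the permutation matrix of the permutation $\pi$ of $\{1,\dots,2d\}$ with $\pi(i)=2i-1$ for $1\le i\le d$ and $\pi(i)=2(i-d)$ for $d+1\le i\le2d$, i.e., $\Sigma_{ij}=1$ if $j=\pi(i)$ and $\Sigma_{ij}=0$ otherwise.
   Context: $\rho(\cdot)$ is the spectral radius and $\mathrm{Diag}(\cdot)$ a block-diagonal matrix. It is assumed throughout that $\lambda_1<\lambda_d$. $A_Q=\begin{bmatrix}(1+\beta)\mathsf I_d-\alpha(1+\nu)Q&-\beta\mathsf I_d+\alpha\nu Q\\ \mathsf I_d&0_d\end{bmatrix}$, $B=\begin{bmatrix}-\alpha\mathsf I_d\\0_d\end{bmatrix}\in\mathbb{R}^{2d\times d}$, $T=\begin{bmatrix}\frac1{\sqrt2}\Lambda^{1/2}U^\top&0_d\end{bmatrix}\in\mathbb{R}^{d\times2d}$, $\tilde B=\begin{bmatrix}-\alpha\\0\end{bmatrix}$, $\tilde A^{(\lambda)}=\begin{bmatrix}1+\beta-\alpha(1+\nu)\lambda&-\beta+\alpha\nu\lambda\\1&0\end{bmatrix}$. The stabilizing solution $\tilde X^{(\lambda_i)}$ of the $2\times2$ equation is the positive semi-definite solution satisfying $\rho(\tilde A^{(\lambda_i)}+\gamma^{-2}\tilde B\tilde B^\top\tilde X^{(\lambda_i)})<1$. $H_\infty$ is given by $$H_\infty=\frac{\alpha}{\sqrt2}\max_{1\le i\le d}\frac{\sqrt{\lambda_i}}{\tilde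 s_{\lambda_i}},\qquad \tilde s_\lambda=\begin{cases}|1-\tilde c_\lambda|\sqrt{1-\frac{\tilde b_\lambda^2}{4\tilde c_\lambda}}&\text{if }\tilde c_\lambda>0\text{ and }\frac{|\tilde b_\lambda|(1+\tilde c_\lambda)}{4\tilde c_\lambda}<1,\\ \big||1+\tilde c_\lambda|-|\tilde b_\lambda|\big|&\text{otherwise},\end{cases}$$ with $\tilde b_\lambda=\alpha\lambda(1+\nu)-(1+\beta)$ and $\tilde c_\lambda=\beta-\alpha\lambda\nu$.
   Formalization: "Stabilizing" (for both equations) also requires ρ(A+B(γ²I−BᵀXB)⁻¹BᵀXA)<1 besides ρ(A+γ⁻²BBᵀX)<1; with the printed inequality alone uniqueness fails, e.g. d=2, Q=diag(1,5/4), α=1, β=ν=0, θ=7/5. *)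

theory Defs
  imports
    Complex_Main
    "Jordan_Normal_Form.Matrix"
    "Jordan_Normal_Form.Gauss_Jordan_Elimination"
    "Jordan_Normal_Form.Spectral_Radius"
begin

(* Indices are 0-based: lam i stands for the eigenvalue lambda_(i+1), 0 <= i < d. *)

definition rho :: "real mat \<Rightarrow> real" where
  "rho M = spectral_radius (map_mat complex_of_real M)"

definition pos_def :: "nat \<Rightarrow> real mat \<Rightarrow> bool" where
  "pos_def n M \<longleftrightarrow> M \<in> carrier_mat n n \<and> transpose_mat M = M \<and>
     (\<forall>v\<in>carrier_vec n. v \<noteq> 0\<^sub>v n \<longrightarrow> 0 < v \<bullet> (M *\<^sub>v v))"

definition pos_semidef :: "nat \<Rightarrow> real mat \<Rightarrow> bool" where
  "pos_semidef n M \<longleftrightarrow> M \<in> carrier_mat n n \<and> transpose_mat M = M \<and>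
     (\<forall>v\<in>carrier_vec n. 0 \<le> v \<bullet> (M *\<^sub>v v))"

(* Orthonormal columns; the library's orthogonal_mat only asks for pairwise orthogonal,
   nonzero columns. *)
definition orthonormal :: "nat \<Rightarrow> real mat \<Rightarrow> bool" where
  "orthonormal n M \<longleftrightarrow> M \<in> carrier_mat n n \<and>
     transpose_mat M * M = 1\<^sub>m n \<and> M * transpose_mat M = 1\<^sub>m n"

(* Meaningful only for invertible M; every use below is guarded by invertible_mat. *)
abbreviation minv :: "real mat \<Rightarrow> real mat" where
  "minv M \<equiv> the (mat_inverse M)"


definition A_mat :: "nat \<Rightarrow> real \<Rightarrow> real \<Rightarrow> real \<Rightarrow> real mat \<Rightarrow> real mat" where
  "A_mat d \<alpha> \<beta> \<nu> Q = four_block_mat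
     ((1 + \<beta>) \<cdot>\<^sub>m 1\<^sub>m d - (\<alpha> * (1 + \<nu>)) \<cdot>\<^sub>m Q) ((- \<beta>) \<cdot>\<^sub>m 1\<^sub>m d + (\<alpha> * \<nu>) \<cdot>\<^sub>m Q)
     (1\<^sub>m d) (0\<^sub>m d d)"

definition B_mat :: "nat \<Rightarrow> real \<Rightarrow> real mat" where
  "B_mat d \<alpha> = ((- \<alpha>) \<cdot>\<^sub>m 1\<^sub>m d) @\<^sub>r (0\<^sub>m d d)"

(* A 1 x 2 block matrix, hence the empty lower blocks. *)
definition T_mat :: "nat \<Rightarrow> real mat \<Rightarrow> (nat \<Rightarrow> real) \<Rightarrow> real mat" where
  "T_mat d U lam = four_block_mat
     ((1 / sqrt 2) \<cdot>\<^sub>m (mat_diag d (\<lambda>i. sqrt (lam i)) * transpose_mat U)) (0\<^sub>m d d)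
     (0\<^sub>m 0 d) (0\<^sub>m 0 d)"

definition A_tilde :: "real \<Rightarrow> real \<Rightarrow> real \<Rightarrow> real \<Rightarrow> real mat" where
  "A_tilde \<alpha> \<beta> \<nu> l = mat_of_rows_list 2
     [[1 + \<beta> - \<alpha> * (1 + \<nu>) * l, - \<beta> + \<alpha> * \<nu> * l],
      [1, 0]]"

definition B_tilde :: "real \<Rightarrow> real mat" where
  "B_tilde \<alpha> = mat_of_rows_list 1 [[- \<alpha>], [0]]"

definition S_tilde :: "real \<Rightarrow> real mat" where
  "S_tilde l = mat_of_rows_list 2 [[l / 2, 0], [0, 0]]"


definition b_tilde :: "real \<Rightarrow> real \<Rightarrow> real \<Rightarrow> real \<Rightarrow> real" where
  "b_tilde \<alpha> \<beta> \<nu> l = \<alpha> * l * (1 + \<nu>) - (1 + \<beta>)"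

definition c_tilde :: "real \<Rightarrow> real \<Rightarrow> real \<Rightarrow> real \<Rightarrow> real" where
  "c_tilde \<alpha> \<beta> \<nu> l = \<beta> - \<alpha> * l * \<nu>"

definition s_tilde :: "real \<Rightarrow> real \<Rightarrow> real \<Rightarrow> real \<Rightarrow> real" where
  "s_tilde \<alpha> \<beta> \<nu> l =
     (let b = b_tilde \<alpha> \<beta> \<nu> l; c = c_tilde \<alpha> \<beta> \<nu> l in
      if c > 0 \<and> \<bar>b\<bar> * (1 + c) / (4 * c) < 1
      then \<bar>1 - c\<bar> * sqrt (1 - b\<^sup>2 / (4 * c))
      else \<bar>\<bar>1 + c\<bar> - \<bar>b\<bar>\<bar>)"

definition H_inf :: "nat \<Rightarrow> real \<Rightarrow> real \<Rightarrow> real \<Rightarrow> (nat \<Rightarrow> real) \<Rightarrow> real" where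
  "H_inf d \<alpha> \<beta> \<nu> lam =
     \<alpha> / sqrt 2 * Max ((\<lambda>i. sqrt (lam i) / s_tilde \<alpha> \<beta> \<nu> (lam i)) ` {..<d})"


(* Here A is n x n, B is n x m and S is n x n; the 2 x 2 equation is the case n = 2, m = 1,
   with the scalar gamma^2 - B^T X B as a 1 x 1 matrix. Both equations presuppose the
   displayed inverse, hence the conjunct invertible_mat. *)

definition gap :: "nat \<Rightarrow> real mat \<Rightarrow> real \<Rightarrow> real mat \<Rightarrow> real mat" where
  "gap m B \<gamma> X = \<gamma>\<^sup>2 \<cdot>\<^sub>m 1\<^sub>m m - transpose_mat B * X * B"

definition riccati_solution ::
  "nat \<Rightarrow> nat \<Rightarrow> real mat \<Rightarrow> real mat \<Rightarrow> real mat \<Rightarrow> real \<Rightarrow> real mat \<Rightarrow> bool" where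
  "riccati_solution n m A B S \<gamma> X \<longleftrightarrow>
     X \<in> carrier_mat n n \<and> invertible_mat (gap m B \<gamma> X) \<and>
     X = transpose_mat A * X * A
         + transpose_mat A * X * B * minv (gap m B \<gamma> X) * transpose_mat B * X * A
         + S"

definition closed_loop :: "nat \<Rightarrow> real mat \<Rightarrow> real mat \<Rightarrow> real \<Rightarrow> real mat \<Rightarrow> real mat" where
  "closed_loop m A B \<gamma> X = A + B * minv (gap m B \<gamma> X) * transpose_mat B * X * A"

(* Besides rho (A + gamma^-2 B B^T X) < 1, the closed-loop matrix of the discrete-time equation,
   A + B (gamma^2 I - B^T X B)^-1 B^T X A = (I - gamma^-2 B B^T X)^-1 A, is required to be Schur
   stable. The first inequality alone does not determine X: for d = 2, U = I, Q = diag(1, 5/4),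
   alpha = 1, beta = nu = 0, theta = 7/5 (gamma^2 = 10/7), both
   X = diag(1/2, 5/7, 0, 0) and X = diag(1/2, 5/4, 0, 0) are positive semidefinite solutions of
   the 4 x 4 equation satisfying it (and so are diag(5/7, 0) and diag(5/4, 0) for the 2 x 2
   equation at lambda = 5/4). Only the solution with 5/7 has a stable closed loop. *)
definition stabilizing_solution ::
  "nat \<Rightarrow> nat \<Rightarrow> real mat \<Rightarrow> real mat \<Rightarrow> real mat \<Rightarrow> real \<Rightarrow> real mat \<Rightarrow> bool" where
  "stabilizing_solution n m A B S \<gamma> X \<longleftrightarrow>
     riccati_solution n m A B S \<gamma> X \<and> transpose_mat X = X \<and>
     rho (A + (1 / \<gamma>\<^sup>2) \<cdot>\<^sub>m (B * transpose_mat B * X)) < 1 \<and>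
     rho (closed_loop m A B \<gamma> X) < 1"

definition stabilizing_full ::
  "nat \<Rightarrow> real \<Rightarrow> real \<Rightarrow> real \<Rightarrow> real mat \<Rightarrow> real mat \<Rightarrow> (nat \<Rightarrow> real) \<Rightarrow> real \<Rightarrow> real mat \<Rightarrow> bool"
  where
  "stabilizing_full d \<alpha> \<beta> \<nu> Q U lam \<gamma> X \<longleftrightarrow>
     stabilizing_solution (2 * d) d (A_mat d \<alpha> \<beta> \<nu> Q) (B_mat d \<alpha>)
       (transpose_mat (T_mat d U lam) * T_mat d U lam) \<gamma> X"

definition stabilizing_2x2 ::
  "real \<Rightarrow> real \<Rightarrow> real \<Rightarrow> real \<Rightarrow> real \<Rightarrow> real mat \<Rightarrow> bool" where
  "stabilizing_2x2 \<alpha> \<beta> \<nu> l \<gamma> X \<longleftrightarrow>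
     pos_semidef 2 X \<and>
     stabilizing_solution 2 1 (A_tilde \<alpha> \<beta> \<nu> l) (B_tilde \<alpha>) (S_tilde l) \<gamma> X"


(* 0-based form of pi(i) = 2i - 1 for 1 <= i <= d and pi(i) = 2(i - d) for d + 1 <= i <= 2d. *)
definition perm_pi :: "nat \<Rightarrow> nat \<Rightarrow> nat" where
  "perm_pi d i = (if i < d then 2 * i else 2 * (i - d) + 1)"

definition Sigma_mat :: "nat \<Rightarrow> real mat" where
  "Sigma_mat d = mat (2 * d) (2 * d) (\<lambda>(i, j). if j = perm_pi d i then 1 else 0)"

definition Y_mat :: "nat \<Rightarrow> real mat \<Rightarrow> real mat" where
  "Y_mat d U = diag_block_mat [U, U] * Sigma_mat d"

end

theory Submission
  imports Defs
begin

text \<open>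
  Any two stabilizing solutions \<open>X\<close>, \<open>Z\<close> of a Riccati equation with closed loops \<open>L\<close>, \<open>M\<close> satisfy
  \<open>X - Z = M\<^sup>T (X - Z) L\<close>, because \<open>X = A\<^sup>T X L + S\<close> and \<open>A = (I - \<gamma>\<^sup>-\<^sup>2 B B\<^sup>T X) L\<close>; as \<open>L\<close> and \<open>M\<close> are Schur
  stable, \<open>X = Z\<close>.

  For the \<open>2 \<times> 2\<close> equation the system has characteristic polynomial \<open>p(z) = z\<^sup>2 + b z + c\<close>, and a
  stabilizing solution corresponds to a spectral factorization
  \<open>\<bar>p\<bar>\<^sup>2 - \<alpha>\<^sup>2 \<lambda> / (2 \<gamma>\<^sup>2) = r \<bar>p'\<bar>\<^sup>2\<close> on the unit circle with \<open>p'\<close> stable. It exists since \<open>s_tilde\<close> is the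
  minimum of \<open>\<bar>p\<bar>\<close> on the unit circle and the bound on \<open>H_inf\<close> makes the left-hand side positive.

  Conjugation by \<open>Y\<close> turns the full equation into the direct sum of the \<open>2 \<times> 2\<close> equations, and both the
  equation and the stability conditions are invariant under orthonormal changes of basis and direct sums.
\<close>

section \<open>Spectral radius and the Stein equation\<close>

text \<open>The spectrum is the root set of the characteristic polynomial, nonempty since
  \<open>0 < n\<close>. Similarity, transposition and direct sums are all treated through this
  polynomial.\<close>

lemma rho_less_1_iff:
  assumes M: "M \<in> carrier_mat n n" and n: "0 < n"
  shows "rho M < 1 \<longleftrightarrow>
    (\<forall>z. poly (map_poly complex_of_real (char_poly M)) z = 0 \<longrightarrow> cmod z < 1)"
proof -
  let ?C = "map_mat complex_of_real M"
  have C: "?C \<in> carrier_mat n n" using M by simp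
  have cp: "char_poly ?C = map_poly complex_of_real (char_poly M)"
    using of_real_hom.char_poly_hom[OF M] .
  have sp: "spectrum ?C = {z. poly (map_poly complex_of_real (char_poly M)) z = 0}"
    using spectrum_root_char_poly[OF C] cp by simp
  have fin: "finite (spectrum ?C)" "spectrum ?C \<noteq> {}"
    using card_finite_spectrum[OF C] spectrum_non_empty[OF C n] by auto
  have "rho M < 1 \<longleftrightarrow> (\<forall>z\<in>spectrum ?C. cmod z < 1)"
    unfolding rho_def spectral_radius_def using fin by (subst Max_less_iff) auto
  then show ?thesis by (simp add: sp)
qed

lemma rho_similar:
  assumes "similar_mat M N" "M \<in> carrier_mat n n" "N \<in> carrier_mat n n" "0 < n"
  shows "rho M < 1 \<longleftrightarrow> rho N < 1"
  using rho_less_1_iff[OF assms(2,4)] rho_less_1_iff[OF assms(3,4)]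
    char_poly_similar[OF assms(1)] by simp

lemma rho_transpose:
  assumes "M \<in> carrier_mat n n" "0 < n"
  shows "rho (transpose_mat M) < 1 \<longleftrightarrow> rho M < 1"
  using rho_less_1_iff[of "transpose_mat M" n] rho_less_1_iff[of M n] assms by simp

lemma char_poly_diag_four_block:
  fixes A B :: "'a :: idom mat"
  assumes A: "A \<in> carrier_mat n n" and B: "B \<in> carrier_mat m m"
  shows "char_poly (four_block_mat A (0\<^sub>m n m) (0\<^sub>m m n) B) = char_poly A * char_poly B"
proof -
  have "char_poly_matrix (four_block_mat A (0\<^sub>m n m) (0\<^sub>m m n) B) =
     four_block_mat (char_poly_matrix A) (0\<^sub>m n m) (0\<^sub>m m n) (char_poly_matrix B)"
    using A B by (intro eq_matI) (auto simp: char_poly_matrix_def)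
  then show ?thesis
    unfolding char_poly_def using A B
    by (simp add: det_four_block_mat_upper_right_zero[of _ n _ m])
qed

lemma char_poly_diag_block_mat:
  fixes As :: "'a :: idom mat list"
  assumes "Ball (set As) square_mat"
  shows "char_poly (diag_block_mat As) = prod_list (map char_poly As)"
  using assms
proof (induction As)
  case Nil
  have "det (0\<^sub>m 0 0 :: 'a poly mat) = 1" by simp
  moreover have "char_poly_matrix (0\<^sub>m 0 0 :: 'a mat) = 0\<^sub>m 0 0" 
    by (intro eq_matI) (auto simp: char_poly_matrix_def)
  ultimately show ?case by (simp add: char_poly_def)
next
  case (Cons A As)
  let ?D = "diag_block_mat As"
  have sq: "square_mat A" "square_mat ?D" using Cons.prems diag_block_mat_square[of As] by auto
  then have *: "A \<in> carrier_mat (dim_row A) (dim_row A)"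
    "?D \<in> carrier_mat (dim_row ?D) (dim_row ?D)" by auto
  show ?case using char_poly_diag_four_block[OF *] Cons sq
    by (simp add: Let_def)
qed

text \<open>The characteristic polynomial of a direct sum is the product over the blocks, so its
  roots are the union of theirs.\<close>

lemma rho_diag_block_mat:
  assumes M: "\<And>i. i < d \<Longrightarrow> M i \<in> carrier_mat n n" and "0 < d" "0 < n"
    and D: "diag_block_mat (map M [0..<d]) \<in> carrier_mat (n * d) (n * d)"
  shows "rho (diag_block_mat (map M [0..<d])) < 1 \<longleftrightarrow> (\<forall>i<d. rho (M i) < 1)"
proof -
  interpret hp: map_poly_comm_ring_hom complex_of_real ..
  have cp: "char_poly (diag_block_mat (map M [0..<d])) = (\<Prod>i<d. char_poly (M i))"
    using carrier_matD[OF M] by (subst char_poly_diag_block_mat)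
      (auto simp: comp_def prod.list_conv_set_nth lessThan_atLeast0)
  have "rho (diag_block_mat (map M [0..<d])) < 1 \<longleftrightarrow>
    (\<forall>z. (\<exists>i<d. poly (map_poly complex_of_real (char_poly (M i))) z = 0) \<longrightarrow> cmod z < 1)"
    using assms by (subst rho_less_1_iff[OF D]) (auto simp: cp hp.hom_prod poly_prod)
  also have "\<dots> \<longleftrightarrow> (\<forall>i<d. rho (M i) < 1)"
    using rho_less_1_iff[OF M assms(3)] by blast
  finally show ?thesis .
qed

text \<open>Scaling by \<open>1 / r\<close> with \<open>rho M < r < 1\<close> keeps the spectral
  radius below 1, hence the scaled powers bounded, so the entries of \<open>M ^\<^sub>m k\<close>
  are of order \<open>r ^ k\<close>.\<close>

lemma rho_pow_mat_tendsto_0: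
  assumes M: "M \<in> carrier_mat n n" and rho: "rho M < 1" and ij: "i < n" "j < n"
  shows "(\<lambda>k. (M ^\<^sub>m k) $$ (i, j)) \<longlonglongrightarrow> 0"
proof -
  have n: "0 < n" using ij by simp
  \<comment> \<open>Midpoint between \<open>rho M\<close> and 1; the maximum with 0 makes
    \<open>0 < r\<close> evident.\<close>
  define r where "r = (1 + max 0 (rho M)) / 2"
  have r: "0 < r" "r < 1" "rho M < r" using rho by (auto simp: r_def)
  let ?C = "map_mat complex_of_real M"
  define N where "N = complex_of_real (1 / r) \<cdot>\<^sub>m ?C"
  have C: "?C \<in> carrier_mat n n" and N: "N \<in> carrier_mat n n" using M by (auto simp: N_def)
  have pow: "N ^\<^sub>m k = complex_of_real (1 / r) ^ k \<cdot>\<^sub>m map_mat complex_of_real (M ^\<^sub>m k)" for k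
  proof (induction k)
    case 0
    show ?case using M by (intro eq_matI) (auto simp: N_def)
  next
    case (Suc k)
    have P: "M ^\<^sub>m k \<in> carrier_mat n n" using M by simp
    then have Pc: "map_mat complex_of_real (M ^\<^sub>m k) \<in> carrier_mat n n" by simp
    let ?P = "map_mat complex_of_real (M ^\<^sub>m k)"
    have "N ^\<^sub>m Suc k = (complex_of_real (1 / r) ^ k \<cdot>\<^sub>m ?P) * (complex_of_real (1 / r) \<cdot>\<^sub>m ?C)"
      using Suc by (simp add: N_def)
    also have "\<dots> = (complex_of_real (1 / r) ^ Suc k) \<cdot>\<^sub>m (?P * ?C)"
      using Pc C by (intro eq_matI) (auto simp: mult_ac)
    also have "?P * ?C = map_mat complex_of_real (M ^\<^sub>m Suc k)"
      by (simp add: of_real_hom.mat_hom_mult[OF P M])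
    finally show ?case .
  qed
  \<comment> \<open>An eigenvalue \<open>z\<close> of \<open>N\<close> gives the eigenvalue
    \<open>r * z\<close> of \<open>?C\<close>, so \<open>r * cmod z\<close> is at most
    \<open>rho M\<close>.\<close>
  have "spectral_radius N < 1"
  proof -
    obtain z where z: "eigenvalue N z" "spectral_radius N = cmod z"
      using spectral_radius_mem_max(1)[OF N n] by (auto simp: spectrum_def)
    then obtain v where v: "v \<in> carrier_vec n" "v \<noteq> 0\<^sub>v n" "N *\<^sub>v v = z \<cdot>\<^sub>v v"
      using N by (auto simp: eigenvalue_def eigenvector_def)
    have "?C *\<^sub>v v = (complex_of_real r * z) \<cdot>\<^sub>v v"
    proof (rule eq_vecI)
      fix a assume a: "a < dim_vec ((complex_of_real r * z) \<cdot>\<^sub>v v)"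
      then have a: "a < n" using v by simp
      have "(N *\<^sub>v v) $ a = z * v $ a" using v a by simp
      moreover have "(N *\<^sub>v v) $ a = complex_of_real (1 / r) * (?C *\<^sub>v v) $ a"
        using a C v(1) by (simp add: N_def)
      ultimately show "(?C *\<^sub>v v) $ a = ((complex_of_real r * z) \<cdot>\<^sub>v v) $ a"
        using a v r by (simp add: field_simps)
    qed (use C v in simp)
    then have "eigenvalue ?C (complex_of_real r * z)"
      using v C by (auto simp: eigenvalue_def eigenvector_def)
    then have "cmod (complex_of_real r * z) \<le> spectral_radius ?C"
      by (intro spectral_radius_mem_max(2)[OF C n]) (auto simp: spectrum_def)
    then have "r * cmod z \<le> rho M" using r(1) by (simp add: norm_mult rho_def)
    then have "r * cmod z < r * 1" using r(3) by linarith
    then show ?thesis using r(1) z(2) by (simp only: mult_less_cancel_left_pos)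
  qed
  then obtain c where c: "\<And>k. norm_bound (N ^\<^sub>m k) c"
    using spectral_radius_jnf_norm_bound_less_1_upper_triangular[OF N] by blast
  have "norm ((M ^\<^sub>m k) $$ (i, j)) \<le> norm (r ^ k) * c" for k
  proof -
    have P: "M ^\<^sub>m k \<in> carrier_mat n n" using M by simp
    have "cmod ((N ^\<^sub>m k) $$ (i, j)) \<le> c"
      using c[of k] ij N pow_carrier_mat[OF N, of k] by (auto simp: norm_bound_def)
    also have "cmod ((N ^\<^sub>m k) $$ (i, j)) = \<bar>(M ^\<^sub>m k) $$ (i, j)\<bar> / r ^ k"
      using ij carrier_matD[OF M] r by (simp add: pow norm_mult norm_power norm_divide power_divide)
    finally show ?thesis using r by (simp add: field_simps)
  qed
  then show ?thesis
    using r by (intro tendsto_0_le[of "\<lambda>k. r ^ k" _ _ c, OF LIMSEQ_realpow_zero]) auto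
qed

text \<open>Iterating the equation gives \<open>D = M ^\<^sub>m k * D * N ^\<^sub>m k\<close>, whose
  entries tend to 0.\<close>

lemma stein_unique:
  assumes D: "D \<in> carrier_mat n n" and M: "M \<in> carrier_mat n n" and N: "N \<in> carrier_mat n n"
    and rho: "rho M < 1" "rho N < 1" and eq: "D = M * D * N"
  shows "D = 0\<^sub>m n n"
proof -
  have P: "M ^\<^sub>m k \<in> carrier_mat n n" "N ^\<^sub>m k \<in> carrier_mat n n" for k
    using M N by auto
  have pow: "D = M ^\<^sub>m k * D * N ^\<^sub>m k" for k
  proof (induction k)
    case 0 show ?case using D M N by simp
  next
    case (Suc k)
    \<comment> \<open>Powers unfold on the right, whereas the new factor \<open>N\<close> has to
      stand next to \<open>D\<close>.\<close>
    have comm: "N ^\<^sub>m Suc k = N * N ^\<^sub>m k" 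
    proof (induction k)
      case (Suc k)
      then show ?case using P(2)[of k] N by (simp add: assoc_mult_mat[of _ n n _ n _ n])
    qed (use N in simp)
    have "M ^\<^sub>m Suc k * D * N ^\<^sub>m Suc k = M ^\<^sub>m k * (M * D * N) * N ^\<^sub>m k"
      using P[of k] M N D unfolding comm by (simp add: assoc_mult_mat[of _ n n _ n _ n])
    then show ?case using Suc eq by simp
  qed
  show ?thesis
  proof (rule eq_matI)
    fix i j assume "i < dim_row (0\<^sub>m n n)" "j < dim_col (0\<^sub>m n n)"
    then have ij: "i < n" "j < n" by auto
    have "D $$ (i, j) = (\<Sum>a<n. (\<Sum>b<n. (M ^\<^sub>m k) $$ (i, b) * D $$ (b, a)) * (N ^\<^sub>m k) $$ (a, j))" for k
      using ij D carrier_matD[OF M] carrier_matD[OF N]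
      by (subst pow[of k]) (simp add: scalar_prod_def lessThan_atLeast0 del: assoc_mult_mat)
    moreover have "(\<lambda>k. \<Sum>a<n. (\<Sum>b<n. (M ^\<^sub>m k) $$ (i, b) * D $$ (b, a)) * (N ^\<^sub>m k) $$ (a, j)) \<longlonglongrightarrow>
       (\<Sum>a<n. (\<Sum>b<n. 0 * D $$ (b, a)) * 0)"
      by (intro tendsto_intros rho_pow_mat_tendsto_0[OF M rho(1)] rho_pow_mat_tendsto_0[OF N rho(2)])
         (use ij in auto)
    ultimately have "(\<lambda>k::nat. D $$ (i, j)) \<longlonglongrightarrow> 0" by simp
    then show "D $$ (i, j) = 0\<^sub>m n n $$ (i, j)" using ij by (simp add: tendsto_const_iff)
  qed (use D in auto)
qed

section \<open>Uniqueness of stabilizing solutions\<close>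

text \<open>Dimension equations instead of carrier memberships serve as premises here and in the
  next two lemmas, so that simp can discharge them and normalize long products.\<close>

lemma mat_mult_assoc:
  fixes A B C :: "'a :: semiring_0 mat"
  assumes "dim_col A = dim_row B" "dim_col B = dim_row C"
  shows "A * B * C = A * (B * C)"
  using assms by (intro assoc_mult_mat[of _ "dim_row A" "dim_row B" _ "dim_row C" _ "dim_col C"]) auto

lemma mat_distribs:
  fixes A B C :: "real mat"
  shows "dim_col A = dim_row B \<Longrightarrow> dim_row B = dim_row C \<Longrightarrow> dim_col B = dim_col C \<Longrightarrow> A * (B + C) = A * B + A * C"
    and "dim_col A = dim_row C \<Longrightarrow> dim_row A = dim_row B \<Longrightarrow> dim_col A = dim_col B \<Longrightarrow> (A + B) * C = A * C + B * C"
    and "dim_col A = dim_row B \<Longrightarrow> dim_row B = dim_row C \<Longrightarrow> dim_col B = dim_col C \<Longrightarrow> A * (B - C) = A * B - A * C"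
    and "dim_col A = dim_row C \<Longrightarrow> dim_row A = dim_row B \<Longrightarrow> dim_col A = dim_col B \<Longrightarrow> (A - B) * C = A * C - B * C"
    and "dim_col A = dim_row B \<Longrightarrow> k \<cdot>\<^sub>m A * B = k \<cdot>\<^sub>m (A * B)"
    and "dim_col A = dim_row B \<Longrightarrow> A * (k \<cdot>\<^sub>m B) = k \<cdot>\<^sub>m (A * B)"
  by (intro eq_matI; simp add: scalar_prod_def algebra_simps sum.distrib sum_subtractf sum_distrib_left)+

lemma mat_transposes:
  fixes A B :: "real mat"
  shows "dim_col A = dim_row B \<Longrightarrow> transpose_mat (A * B) = transpose_mat B * transpose_mat A"
    and "dim_row A = dim_row B \<Longrightarrow> dim_col A = dim_col B \<Longrightarrow> transpose_mat (A + B) = transpose_mat A + transpose_mat B"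
    and "dim_row A = dim_row B \<Longrightarrow> dim_col A = dim_col B \<Longrightarrow> transpose_mat (A - B) = transpose_mat A - transpose_mat B"
    and "transpose_mat (k \<cdot>\<^sub>m A) = k \<cdot>\<^sub>m transpose_mat A"
  by (intro eq_matI; simp add: scalar_prod_def mult.commute)+

text \<open>A two-sided inverse makes \<open>G\<close> a unit of the matrix ring, so
  \<open>mat_inverse\<close> succeeds; its result agrees with \<open>H\<close> because
  \<open>H' = H G H' = H\<close>.\<close>

lemma minv_eqI:
  assumes "G \<in> carrier_mat n n" "H \<in> carrier_mat n n" "G * H = 1\<^sub>m n" "H * G = 1\<^sub>m n"
  shows "invertible_mat G" "minv G = H"
proof -
  show "invertible_mat G"
    using assms by (auto simp: invertible_mat_def inverts_mat_def intro!: exI[of _ H])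
  have "G \<in> Units (ring_mat TYPE(real) n ())"
    using assms by (auto simp: Units_def ring_mat_simps)
  then obtain H' where H': "mat_inverse G = Some H'"
    using mat_inverse(1)[OF assms(1), where b = "()"] by (cases "mat_inverse G") auto
  from mat_inverse(2)[OF assms(1) this]
  have "G * H' = 1\<^sub>m n" "H' \<in> carrier_mat n n" by auto
  then have "H' = H * G * H'" "H * (G * H') = H" using assms by auto
  moreover have "H * G * H' = H * (G * H')"
    using assms(1,2) \<open>H' \<in> _\<close> by (subst mat_mult_assoc) auto
  ultimately show "minv G = H" using H' by simp
qed

lemma minv_inverse:
  assumes G: "G \<in> carrier_mat n n" and inv: "invertible_mat G"
  shows "minv G \<in> carrier_mat n n" "G * minv G = 1\<^sub>m n" "minv G * G = 1\<^sub>m n"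
proof -
  obtain H where H: "G * H = 1\<^sub>m n" "H * G = 1\<^sub>m (dim_row H)"
    using assms by (auto simp: invertible_mat_def inverts_mat_def)
  \<comment> \<open>\<open>invertible_mat\<close> does not fix the shape of \<open>H\<close>;
    comparing dimensions in the two identities does.\<close>
  have "dim_col (G * H) = n" "dim_col (H * G) = dim_row H" by (simp_all only: H) auto
  then have "H \<in> carrier_mat n n" using G by auto
  then have "minv G = H" "H \<in> carrier_mat n n" "G * H = 1\<^sub>m n" "H * G = 1\<^sub>m n"
    using minv_eqI(2)[OF G \<open>H \<in> _\<close>] H by auto
  then show "minv G \<in> carrier_mat n n" "G * minv G = 1\<^sub>m n" "minv G * G = 1\<^sub>m n" by auto
qed

section \<open>The closed loop of a Riccati equation\<close>

locale riccati_data =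
  fixes n m :: nat and A B S :: "real mat" and \<gamma> :: real
  assumes A: "A \<in> carrier_mat n n" and B: "B \<in> carrier_mat n m" and S: "S \<in> carrier_mat n n"
    and S_sym: "transpose_mat S = S" and \<gamma>: "\<gamma> \<noteq> 0"
begin

lemmas dims = carrier_matD[OF A] carrier_matD[OF B] carrier_matD[OF S]

context
  fixes X assumes sol: "riccati_solution n m A B S \<gamma> X"
begin

lemma riccati_inverse:
  shows "X \<in> carrier_mat n n" "minv (gap m B \<gamma> X) \<in> carrier_mat m m"
    "gap m B \<gamma> X * minv (gap m B \<gamma> X) = 1\<^sub>m m"
proof -
  have "gap m B \<gamma> X \<in> carrier_mat m m" using B sol by (auto simp: riccati_solution_def gap_def)
  from minv_inverse[OF this] sol
  show "X \<in> carrier_mat n n" "minv (gap m B \<gamma> X) \<in> carrier_mat m m"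
    "gap m B \<gamma> X * minv (gap m B \<gamma> X) = 1\<^sub>m m" by (auto simp: riccati_solution_def)
qed

text \<open>Pulling the common left factor \<open>transpose_mat A * X\<close> out of the first two
  summands leaves exactly the closed loop.\<close>

lemma riccati_closed_loop_form:
  "X = transpose_mat A * X * closed_loop m A B \<gamma> X + S"
proof -
  note d = dims carrier_matD[OF riccati_inverse(1)] carrier_matD[OF riccati_inverse(2)]
  have "X = transpose_mat A * X * A
    + transpose_mat A * X * B * minv (gap m B \<gamma> X) * transpose_mat B * X * A + S"
    using sol unfolding riccati_solution_def by blast
  also have "\<dots> = transpose_mat A * X * closed_loop m A B \<gamma> X + S"
    unfolding closed_loop_def by (simp add: d mat_distribs mat_mult_assoc del: assoc_mult_mat)
  finally show ?thesis .
qed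

text \<open>With \<open>F = B^T X A\<close>, \<open>K = B^T X B\<close> and \<open>H\<close> the
  inverse of the gap, the inverse property reads \<open>\<gamma>^2 H F = F + K H F\<close>. The
  right side is \<open>B^T X L\<close> for the closed loop \<open>L = A + B H F\<close>; multiplying
  by \<open>\<gamma>^-2 B\<close> gives \<open>L - A\<close>.\<close>

lemma closed_loop_factor:
  "A = closed_loop m A B \<gamma> X - (1 / \<gamma>\<^sup>2) \<cdot>\<^sub>m (B * (transpose_mat B * (X * closed_loop m A B \<gamma> X)))"
proof -
  let ?H = "minv (gap m B \<gamma> X)"
  note d = dims carrier_matD[OF riccati_inverse(1)] carrier_matD[OF riccati_inverse(2)]
  define F where "F = transpose_mat B * (X * A)"
  have F: "F \<in> carrier_mat m n" using d by (auto simp: F_def)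
  define K where "K = transpose_mat B * (X * B)"
  have K: "K \<in> carrier_mat m m" using d by (auto simp: K_def)
  have "gap m B \<gamma> X = \<gamma>\<^sup>2 \<cdot>\<^sub>m 1\<^sub>m m - K"
    by (simp add: gap_def K_def d mat_mult_assoc)
  then have "(\<gamma>\<^sup>2 \<cdot>\<^sub>m 1\<^sub>m m - K) * ?H * F = F"
    using riccati_inverse(3) F by simp
  then have "(\<gamma>\<^sup>2 \<cdot>\<^sub>m 1\<^sub>m m - K) * (?H * F) = F"
    using F K d by (simp add: mat_mult_assoc del: assoc_mult_mat)
  then have eqF: "\<gamma>\<^sup>2 \<cdot>\<^sub>m (?H * F) - K * (?H * F) = F"
    using K F d by (simp add: mat_distribs)
  then have HF: "?H * F = (1 / \<gamma>\<^sup>2) \<cdot>\<^sub>m (F + K * (?H * F))"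
  proof -
    have "?H * F = (1 / \<gamma>\<^sup>2) \<cdot>\<^sub>m ((\<gamma>\<^sup>2 \<cdot>\<^sub>m (?H * F) - K * (?H * F)) + K * (?H * F))"
      using K F d \<gamma> by (intro eq_matI) auto
    then show ?thesis using eqF by simp
  qed
  have cl: "closed_loop m A B \<gamma> X = A + B * (?H * F)"
    by (simp add: closed_loop_def F_def d mat_mult_assoc)
  have "transpose_mat B * (X * closed_loop m A B \<gamma> X) = F + K * (?H * F)"
    using F by (simp add: cl F_def K_def d mat_distribs mat_mult_assoc)
  then have "(1 / \<gamma>\<^sup>2) \<cdot>\<^sub>m (B * (transpose_mat B * (X * closed_loop m A B \<gamma> X)))
    = B * (?H * F)"
    using F K d by (subst HF) (simp add: mat_distribs)
  then show ?thesis using d F by (simp add: cl) (intro eq_matI; simp)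
qed

end

text \<open>The difference of two stabilizing solutions is a fixed point of the Stein operator
  of the two closed loops.\<close>

lemma stabilizing_solution_unique:
  assumes "stabilizing_solution n m A B S \<gamma> X" "stabilizing_solution n m A B S \<gamma> Z" and n: "0 < n"
  shows "X = Z"
proof -
  define L M where L_def: "L = closed_loop m A B \<gamma> X" and M_def: "M = closed_loop m A B \<gamma> Z"
  have sol: "riccati_solution n m A B S \<gamma> X" "riccati_solution n m A B S \<gamma> Z"
    and sym: "transpose_mat X = X" "transpose_mat Z = Z" and rho: "rho L < 1" "rho M < 1"
    using assms unfolding stabilizing_solution_def L_def M_def by auto
  note invX = riccati_inverse[OF sol(1)] and invZ = riccati_inverse[OF sol(2)]
  have L: "L \<in> carrier_mat n n" and M: "M \<in> carrier_mat n n"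
    using dims invX invZ by (auto simp: closed_loop_def L_def M_def)
  note d = dims carrier_matD[OF invX(1)] carrier_matD[OF invZ(1)] carrier_matD[OF L] carrier_matD[OF M]
  let ?k = "1 / \<gamma>\<^sup>2"
  let ?T = "transpose_mat M"
  have AL: "A = L - ?k \<cdot>\<^sub>m (B * (transpose_mat B * (X * L)))"
    unfolding L_def by (rule closed_loop_factor[OF sol(1)])
  have "transpose_mat A = transpose_mat (M - ?k \<cdot>\<^sub>m (B * (transpose_mat B * (Z * M))))"
    unfolding M_def by (rule arg_cong[OF closed_loop_factor[OF sol(2)]])
  \<comment> \<open>The factorization through the closed loop of \<open>Z\<close> is transposed so
    that \<open>M\<close> enters from the left, while \<open>AL\<close> brings in \<open>L\<close>
    from the right.\<close>
  then have AM: "transpose_mat A = ?T - ?k \<cdot>\<^sub>m (?T * (Z * (B * transpose_mat B)))"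
    by (simp add: mat_transposes mat_mult_assoc d sym)
  \<comment> \<open>Symmetry of \<open>Z\<close> and \<open>S\<close> permits transposing the
    equation, which moves \<open>M\<close> to the left and \<open>A\<close> to the right.\<close>
  have "Z = transpose_mat Z" by (simp add: sym)
  also have "transpose_mat Z = transpose_mat (transpose_mat A * Z * M + S)"
    unfolding M_def by (rule arg_cong[OF riccati_closed_loop_form[OF sol(2)]])
  also have "\<dots> = ?T * (Z * A) + S"
    by (simp add: mat_transposes mat_mult_assoc d sym S_sym)
  finally have Z: "Z = ?T * (Z * A) + S" .
  have "X = transpose_mat A * X * L + S"
    unfolding L_def by (rule riccati_closed_loop_form[OF sol(1)])
  also have "\<dots> = transpose_mat A * (X * L) + S"
    by (simp add: mat_mult_assoc d)
  finally have X: "X = transpose_mat A * (X * L) + S" .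
  \<comment> \<open>Both \<open>A^T X L\<close> and \<open>M^T Z A\<close> contain this same term,
    which therefore cancels in \<open>X - Z\<close>.\<close>
  define R where "R = ?k \<cdot>\<^sub>m (?T * (Z * (B * (transpose_mat B * (X * L)))))"
  have R: "R \<in> carrier_mat n n" by (rule carrier_matI) (simp_all add: R_def d)
  have E1: "transpose_mat A * (X * L) = ?T * (X * L) - R"
    by (subst AM) (simp add: mat_distribs mat_mult_assoc d R_def)
  have E2: "?T * (Z * A) = ?T * (Z * L) - R"
    by (subst AL) (simp add: mat_distribs mat_mult_assoc d R_def)
  have XZ: "X = ?T * (X * L) - R + S" "Z = ?T * (Z * L) - R + S"
    using X Z unfolding E1 E2 by this+
  have "X - Z = (?T * (X * L) - R + S) - (?T * (Z * L) - R + S)"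
    using XZ by (rule arg_cong2)
  also have "\<dots> = ?T * (X * L) - ?T * (Z * L)"
    using R by (intro eq_matI) (auto simp: d)
  also have "\<dots> = ?T * (X - Z) * L"
    by (simp add: mat_distribs mat_mult_assoc d)
  finally have "X - Z = 0\<^sub>m n n"
    using rho L M invX invZ n by (intro stein_unique[of _ n ?T L]) (auto simp: rho_transpose)
  then have "Z + (X - Z) = Z" using invZ(1) by simp
  moreover have "Z + (X - Z) = X" using invX(1) invZ(1) by (intro eq_matI) auto
  ultimately show ?thesis by simp
qed

end

section \<open>Direct sums and orthonormal changes of basis\<close>

text \<open>Indexing the blocks by a function allows induction on \<open>d\<close> that splits off
  the last block.\<close>

definition block_diag :: "nat \<Rightarrow> (nat \<Rightarrow> 'a :: zero mat) \<Rightarrow> 'a mat" where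
  "block_diag d M = diag_block_mat (map M [0..<d])"

lemma block_diag_0 [simp]: "block_diag 0 M = 0\<^sub>m 0 0"
  by (simp add: block_diag_def)

lemma block_diag_Suc:
  "block_diag (Suc d) M = four_block_mat (block_diag d M)
     (0\<^sub>m (dim_row (block_diag d M)) (dim_col (M d)))
     (0\<^sub>m (dim_row (M d)) (dim_col (block_diag d M))) (M d)"
  by (simp add: block_diag_def diag_block_mat_last Let_def)

lemma dim_block_diag:
  "dim_row (block_diag d M) = (\<Sum>i<d. dim_row (M i))"
  "dim_col (block_diag d M) = (\<Sum>i<d. dim_col (M i))"
  by (induction d) (auto simp: block_diag_Suc)

lemma block_diag_carrier:
  assumes "\<And>i. i < d \<Longrightarrow> M i \<in> carrier_mat r c"
  shows "block_diag d M \<in> carrier_mat (r * d) (c * d)"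
  using carrier_matD[OF assms] by (auto simp: dim_block_diag)

lemma block_diag_index:
  assumes "\<And>i. i < d \<Longrightarrow> M i \<in> carrier_mat r c" "i < r * d" "j < c * d"
  shows "block_diag d M $$ (i, j) =
    (if i div r = j div c then M (i div r) $$ (i mod r, j mod c) else 0)"
  using assms
proof (induction d)
  case (Suc d)
  have r: "0 < r" and c: "0 < c" using Suc.prems by (auto intro: gr0I)
  have D: "block_diag d M \<in> carrier_mat (r * d) (c * d)" and M: "M d \<in> carrier_mat r c"
    using Suc.prems block_diag_carrier[of d M r c] by auto
    have div: "k div q < d" if "k < q * d" for k q :: nat
    using that by (simp add: less_mult_imp_div_less mult.commute)
  have div': "k div q = d \<and> k mod q = k - q * d" if "\<not> k < q * d" "k < q * Suc d" for k q :: nat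
  proof -
    define s where "s = k - q * d"
    have "k = q * d + s" "s < q" using that by (auto simp: s_def)
    then show ?thesis by simp
  qed
  show ?case
  proof (cases "i < r * d")
    case True
    note i = this div[OF True]
    show ?thesis
    proof (cases "j < c * d")
      case True
      then show ?thesis using i Suc.IH[OF Suc.prems(1)] carrier_matD[OF D] carrier_matD[OF M] by (subst block_diag_Suc) auto
    next
      case False
      then show ?thesis using i div'[OF False] Suc.prems carrier_matD[OF D] carrier_matD[OF M] by (subst block_diag_Suc) auto
    qed
  next
    case False
    note i = this div'[OF False Suc.prems(2)]
    show ?thesis
    proof (cases "j < c * d")
      case True
      then show ?thesis using i div[OF True] Suc.prems carrier_matD[OF D] carrier_matD[OF M] by (subst block_diag_Suc) auto
    next
      case False
      then show ?thesis using i div'[OF False] Suc.prems carrier_matD[OF D] carrier_matD[OF M] by (subst block_diag_Suc) auto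
    qed
  qed
qed auto

lemma mult_diag_four_block_mat:
  fixes A B C D :: "real mat"
  assumes "A \<in> carrier_mat a b" "C \<in> carrier_mat b c" "B \<in> carrier_mat r k" "D \<in> carrier_mat k s"
  shows "four_block_mat A (0\<^sub>m a k) (0\<^sub>m r b) B * four_block_mat C (0\<^sub>m b s) (0\<^sub>m k c) D
    = four_block_mat (A * C) (0\<^sub>m a s) (0\<^sub>m r c) (B * D)"
  using assms by (simp add: mult_four_block_mat[of _ a b _ k _ r _ _ c _ s]
    left_mult_zero_mat[of C b c] left_mult_zero_mat[of D k s]
    right_mult_zero_mat[of A a b] right_mult_zero_mat[of B r k])

text \<open>Only the inner dimensions of corresponding blocks must agree, so the rectangular blocks
  \<open>B_tilde\<close> are covered.\<close>

lemma block_diag_mult: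
  fixes M N :: "nat \<Rightarrow> real mat"
  assumes "\<And>i. i < d \<Longrightarrow> dim_col (M i) = dim_row (N i)"
  shows "block_diag d M * block_diag d N = block_diag d (\<lambda>i. M i * N i)"
  using assms
proof (induction d)
  case (Suc d)
  let ?M = "block_diag d M" and ?N = "block_diag d N"
  have "(\<Sum>i<d. dim_row (N i)) = (\<Sum>i<d. dim_col (M i))"
    by (rule sum.cong) (auto simp: Suc.prems)
  then have dims: "dim_row ?N = dim_col ?M" "dim_row (N d) = dim_col (M d)"
    unfolding dim_block_diag using Suc.prems[OF lessI] by simp_all
  have c: "?M \<in> carrier_mat (dim_row ?M) (dim_col ?M)" "?N \<in> carrier_mat (dim_col ?M) (dim_col ?N)"
    "M d \<in> carrier_mat (dim_row (M d)) (dim_col (M d))"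
    "N d \<in> carrier_mat (dim_col (M d)) (dim_col (N d))"
    by (auto simp only: carrier_mat_def dims)
  have IH: "?M * ?N = block_diag d (\<lambda>i. M i * N i)"
    by (rule Suc.IH) (rule Suc.prems, rule less_SucI)
  show ?case unfolding block_diag_Suc dims
    by (simp add: mult_diag_four_block_mat[OF c] flip: IH)
qed auto

lemma block_diag_add:
  fixes M N :: "nat \<Rightarrow> real mat"
  assumes "\<And>i. i < d \<Longrightarrow> dim_row (M i) = dim_row (N i)" "\<And>i. i < d \<Longrightarrow> dim_col (M i) = dim_col (N i)"
  shows "block_diag d M + block_diag d N = block_diag d (\<lambda>i. M i + N i)"
  using assms
proof (induction d)
  case (Suc d)
  let ?M = "block_diag d M" and ?N = "block_diag d N"
  have dims: "dim_row ?M = dim_row ?N" "dim_col ?M = dim_col ?N"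
    unfolding dim_block_diag by (rule sum.cong; simp add: Suc.prems)+
  have dims': "dim_row (M d) = dim_row (N d)" "dim_col (M d) = dim_col (N d)"
    using Suc.prems by simp_all
  have IH: "?M + ?N = block_diag d (\<lambda>i. M i + N i)"
    by (rule Suc.IH) (simp_all add: Suc.prems)
  show ?case unfolding block_diag_Suc dims dims' IH[symmetric]
    by (intro eq_matI) (auto simp: dims dims')
qed auto

lemma block_diag_minus:
  fixes M N :: "nat \<Rightarrow> real mat"
  assumes "\<And>i. i < d \<Longrightarrow> dim_row (M i) = dim_row (N i)" "\<And>i. i < d \<Longrightarrow> dim_col (M i) = dim_col (N i)"
  shows "block_diag d M - block_diag d N = block_diag d (\<lambda>i. M i - N i)"
  using assms
proof (induction d)
  case (Suc d)
  let ?M = "block_diag d M" and ?N = "block_diag d N"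
  have dims: "dim_row ?M = dim_row ?N" "dim_col ?M = dim_col ?N"
    unfolding dim_block_diag by (rule sum.cong; simp add: Suc.prems)+
  have dims': "dim_row (M d) = dim_row (N d)" "dim_col (M d) = dim_col (N d)"
    using Suc.prems by simp_all
  have IH: "?M - ?N = block_diag d (\<lambda>i. M i - N i)"
    by (rule Suc.IH) (simp_all add: Suc.prems)
  show ?case unfolding block_diag_Suc dims dims' IH[symmetric]
    by (intro eq_matI) (auto simp: dims dims')
qed auto

lemma block_diag_smult:
  fixes M :: "nat \<Rightarrow> real mat"
  shows "a \<cdot>\<^sub>m block_diag d M = block_diag d (\<lambda>i. a \<cdot>\<^sub>m M i)"
proof (induction d)
  case (Suc d)
  show ?case unfolding block_diag_Suc
    by (intro eq_matI) (auto simp: dim_block_diag simp flip: Suc.IH)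
qed auto

lemma block_diag_transpose:
  "transpose_mat (block_diag d M) = block_diag d (\<lambda>i. transpose_mat (M i))"
proof (induction d)
  case (Suc d)
  show ?case unfolding block_diag_Suc
    by (intro eq_matI) (auto simp: dim_block_diag simp flip: Suc.IH)
qed auto

lemma block_diag_one: "block_diag d (\<lambda>i. 1\<^sub>m r) = 1\<^sub>m (r * d)"
proof (induction d)
  case (Suc d)
  show ?case unfolding block_diag_Suc Suc by (intro eq_matI) auto
qed auto

lemma block_diag_cong: "(\<And>i. i < d \<Longrightarrow> M i = N i) \<Longrightarrow> block_diag d M = block_diag d N"
  unfolding block_diag_def by (intro arg_cong[of _ _ diag_block_mat]) auto

section \<open>Transport of stabilizing solutions\<close>

lemma orthonormal_dims:
  assumes "orthonormal n P"
  shows "dim_row P = n" "dim_col P = n"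
  using assms by (auto simp: orthonormal_def)

text \<open>The last two forms let simp cancel \<open>P\<close> also inside products associated to
  the right.\<close>

lemma orthonormal_cancel:
  assumes "orthonormal n P"
  shows "transpose_mat P * P = 1\<^sub>m n" "P * transpose_mat P = 1\<^sub>m n"
    "dim_row Z = n \<Longrightarrow> transpose_mat P * (P * Z) = Z"
    "dim_row Z = n \<Longrightarrow> P * (transpose_mat P * Z) = Z"
proof -
  have P: "P \<in> carrier_mat n n" and o: "transpose_mat P * P = 1\<^sub>m n" "P * transpose_mat P = 1\<^sub>m n"
    using assms by (auto simp: orthonormal_def)
  show "transpose_mat P * P = 1\<^sub>m n" "P * transpose_mat P = 1\<^sub>m n" by fact+
  assume Z: "dim_row Z = n"
  then have Zc: "Z \<in> carrier_mat n (dim_col Z)" by auto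
  have "transpose_mat P * (P * Z) = transpose_mat P * P * Z" 
    using P Z by (subst mat_mult_assoc) auto
  then show "transpose_mat P * (P * Z) = Z" using o Zc by simp
  have "P * (transpose_mat P * Z) = P * transpose_mat P * Z" 
    using P Z by (subst mat_mult_assoc) auto
  then show "P * (transpose_mat P * Z) = Z" using o Zc by simp
qed

lemma gap_carrier:
  "dim_col B = m \<Longrightarrow> gap m B \<gamma> X \<in> carrier_mat m m"
  by (auto simp: gap_def)

lemma rho_conj_orthonormal:
  assumes P: "orthonormal n P" and M: "M \<in> carrier_mat n n" and n: "0 < n"
  shows "rho (P * M * transpose_mat P) < 1 \<longleftrightarrow> rho M < 1"
proof (rule rho_similar)
  have c: "P \<in> carrier_mat n n" using P by (simp add: orthonormal_def)
  show "similar_mat (P * M * transpose_mat P) M"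
    using P M c by (intro similar_matI[of _ _ P "transpose_mat P" n]) (auto simp: orthonormal_def)
  show "P * M * transpose_mat P \<in> carrier_mat n n"
    using M c by auto
qed (use M n in auto)

lemma rho_block_diag:
  assumes M: "\<And>i. i < d \<Longrightarrow> M i \<in> carrier_mat n n" and "0 < d" "0 < n"
  shows "rho (block_diag d M) < 1 \<longleftrightarrow> (\<forall>i<d. rho (M i) < 1)"
  using rho_diag_block_mat[OF assms block_diag_carrier[OF M, unfolded block_diag_def]]
  by (simp add: block_diag_def)

context riccati_data
begin

text \<open>State coordinates change by \<open>P\<close> and input coordinates independently by
  \<open>W\<close>. The gap becomes \<open>W G W^T\<close> with inverse \<open>W H W^T\<close>, the
  inner factors cancel, and both stability matrices become similar to the old ones.\<close>

lemma stabilizing_solution_orthonormal: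
  assumes P: "orthonormal n P" and W: "orthonormal m W" and n: "0 < n"
    and stab: "stabilizing_solution n m A B S \<gamma> X"
  shows "stabilizing_solution n m (P * A * transpose_mat P) (P * B * transpose_mat W)
    (P * S * transpose_mat P) \<gamma> (P * X * transpose_mat P)"
proof -
  let ?A = "P * A * transpose_mat P" and ?B = "P * B * transpose_mat W"
    and ?S = "P * S * transpose_mat P" and ?X = "P * X * transpose_mat P"
  have sol: "riccati_solution n m A B S \<gamma> X" and sym: "transpose_mat X = X"
    and rho: "rho (A + (1 / \<gamma>\<^sup>2) \<cdot>\<^sub>m (B * transpose_mat B * X)) < 1"
      "rho (closed_loop m A B \<gamma> X) < 1"
    using stab by (auto simp: stabilizing_solution_def)
  have X: "X \<in> carrier_mat n n" and inv: "invertible_mat (gap m B \<gamma> X)"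
    and eq: "X = transpose_mat A * X * A
      + transpose_mat A * X * B * minv (gap m B \<gamma> X) * transpose_mat B * X * A + S"
    using sol unfolding riccati_solution_def by blast+
  define G H where "G = gap m B \<gamma> X" and "H = minv G"
  have G: "G \<in> carrier_mat m m" using dims by (auto simp: G_def intro: gap_carrier)
  note H = minv_inverse[OF G inv[folded G_def], folded H_def]
  note d = dims carrier_matD[OF X] carrier_matD[OF G] carrier_matD[OF H(1)]
    orthonormal_dims[OF P] orthonormal_dims[OF W]
  note c = orthonormal_cancel[OF P] orthonormal_cancel[OF W]
  note simps = d c mat_transposes mat_distribs mat_mult_assoc
  have one: "W * transpose_mat W = 1\<^sub>m m" by (rule c)
  have gap: "gap m ?B \<gamma> ?X = W * G * transpose_mat W"
    by (simp add: gap_def G_def simps)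
  have GH: "G * (H * Z) = Z" "H * (G * Z) = Z" if "dim_row Z = m" for Z
    using H G that by (simp_all flip: mat_mult_assoc add: d)
  have cW: "W \<in> carrier_mat m m" using W by (simp add: orthonormal_def)
  have "W * G * transpose_mat W * (W * H * transpose_mat W) = 1\<^sub>m m"
    "W * H * transpose_mat W * (W * G * transpose_mat W) = 1\<^sub>m m"
    by (simp_all add: simps GH)
  moreover have "W * G * transpose_mat W \<in> carrier_mat m m" "W * H * transpose_mat W \<in> carrier_mat m m"
    using G H cW by auto
  ultimately have inv': "invertible_mat (W * G * transpose_mat W)"
    "minv (W * G * transpose_mat W) = W * H * transpose_mat W"
    using minv_eqI by blast+
  have inv_gap: "invertible_mat (gap m ?B \<gamma> ?X)" and minv: "minv (gap m ?B \<gamma> ?X) = W * H * transpose_mat W"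
    using inv' unfolding gap by auto
  have cl: "closed_loop m ?A ?B \<gamma> ?X = P * closed_loop m A B \<gamma> X * transpose_mat P"
    unfolding closed_loop_def minv G_def[symmetric] H_def[symmetric] by (simp add: simps)
  have pert: "?A + (1 / \<gamma>\<^sup>2) \<cdot>\<^sub>m (?B * transpose_mat ?B * ?X)
    = P * (A + (1 / \<gamma>\<^sup>2) \<cdot>\<^sub>m (B * transpose_mat B * X)) * transpose_mat P"
    by (simp add: simps)
  have "?X = P * (transpose_mat A * X * A
      + transpose_mat A * X * B * H * transpose_mat B * X * A + S) * transpose_mat P"
    using eq unfolding H_def G_def by (rule arg_cong)
  also have "\<dots> = transpose_mat ?A * ?X * ?A
      + transpose_mat ?A * ?X * ?B * minv (gap m ?B \<gamma> ?X) * transpose_mat ?B * ?X * ?A + ?S"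
    unfolding minv by (simp add: simps)
  finally have "riccati_solution n m ?A ?B ?S \<gamma> ?X"
    unfolding riccati_solution_def using inv_gap d by auto
  moreover have "transpose_mat ?X = ?X" by (simp add: simps sym)
  moreover have "rho (closed_loop m ?A ?B \<gamma> ?X) < 1"
    unfolding cl using d rho(2) 
    by (subst rho_conj_orthonormal[OF P _ n]) (auto simp: closed_loop_def G_def H_def)
  moreover have "rho (?A + (1 / \<gamma>\<^sup>2) \<cdot>\<^sub>m (?B * transpose_mat ?B * ?X)) < 1"
    unfolding pert using d rho(1)
    by (subst rho_conj_orthonormal[OF P _ n]) auto
  ultimately show ?thesis by (simp add: stabilizing_solution_def)
qed

end

text \<open>All operations in the equation act blockwise, including the inverse, since the gap of
  the direct sum is the direct sum of the gaps.\<close>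

lemma stabilizing_solution_block_diag:
  assumes A: "\<And>i. i < d \<Longrightarrow> A i \<in> carrier_mat n n" and B: "\<And>i. i < d \<Longrightarrow> B i \<in> carrier_mat n m"
    and S: "\<And>i. i < d \<Longrightarrow> S i \<in> carrier_mat n n" and n: "0 < n" and d: "0 < d"
    and stab: "\<And>i. i < d \<Longrightarrow> stabilizing_solution n m (A i) (B i) (S i) \<gamma> (X i)"
  shows "stabilizing_solution (n * d) (m * d) (block_diag d A) (block_diag d B) (block_diag d S) \<gamma>
    (block_diag d X)"
proof -
  have sol: "riccati_solution n m (A i) (B i) (S i) \<gamma> (X i)" and sym: "transpose_mat (X i) = X i"
    and rho: "rho (A i + (1 / \<gamma>\<^sup>2) \<cdot>\<^sub>m (B i * transpose_mat (B i) * X i)) < 1"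
      "rho (closed_loop m (A i) (B i) \<gamma> (X i)) < 1" if "i < d" for i
    using stab[OF that] by (auto simp: stabilizing_solution_def)
  have X: "X i \<in> carrier_mat n n" and inv: "invertible_mat (gap m (B i) \<gamma> (X i))"
    and eq: "X i = transpose_mat (A i) * X i * A i
      + transpose_mat (A i) * X i * B i * minv (gap m (B i) \<gamma> (X i)) * transpose_mat (B i) * X i * A i + S i" 
      if "i < d" for i
    using sol[OF that] unfolding riccati_solution_def by blast+
  define G H where "G i = gap m (B i) \<gamma> (X i)" and "H i = minv (G i)" for i
  have G: "G i \<in> carrier_mat m m" if "i < d" for i
    using carrier_matD[OF B[OF that]] by (auto simp: G_def intro: gap_carrier)
  have H: "H i \<in> carrier_mat m m" "G i * H i = 1\<^sub>m m" "H i * G i = 1\<^sub>m m" if "i < d" for i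
    using minv_inverse[OF G[OF that] inv[OF that, folded G_def]] by (auto simp: H_def)
  let ?D = "block_diag d"
  note dims = carrier_matD[OF A] carrier_matD[OF B] carrier_matD[OF S] carrier_matD[OF X] carrier_matD[OF H(1)]
  note simps = dims block_diag_transpose block_diag_mult block_diag_add block_diag_minus block_diag_smult
  have gap: "gap (m * d) (?D B) \<gamma> (?D X) = ?D G"
    unfolding gap_def G_def block_diag_one[symmetric] by (simp add: simps)
  have "?D G \<in> carrier_mat (m * d) (m * d)" "?D H \<in> carrier_mat (m * d) (m * d)"
    using G H by (auto intro!: block_diag_carrier)
  moreover have "?D G * ?D H = 1\<^sub>m (m * d)" "?D H * ?D G = 1\<^sub>m (m * d)"
    unfolding block_diag_one[symmetric]
    by (simp_all add: simps carrier_matD[OF G] H cong: block_diag_cong)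
  ultimately have inv_gap: "invertible_mat (gap (m * d) (?D B) \<gamma> (?D X))"
    and minv: "minv (gap (m * d) (?D B) \<gamma> (?D X)) = ?D H"
    unfolding gap using minv_eqI by blast+
  have cl: "closed_loop (m * d) (?D A) (?D B) \<gamma> (?D X) = ?D (\<lambda>i. closed_loop m (A i) (B i) \<gamma> (X i))"
    unfolding closed_loop_def minv G_def[symmetric] H_def[symmetric] by (simp add: simps)
  have cl_c: "closed_loop m (A i) (B i) \<gamma> (X i) \<in> carrier_mat n n" if "i < d" for i
    using that by (auto simp: closed_loop_def dims)
  have pert: "?D A + (1 / \<gamma>\<^sup>2) \<cdot>\<^sub>m (?D B * transpose_mat (?D B) * ?D X)
    = ?D (\<lambda>i. A i + (1 / \<gamma>\<^sup>2) \<cdot>\<^sub>m (B i * transpose_mat (B i) * X i))"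
    by (simp add: simps)
  have "?D X = ?D (\<lambda>i. transpose_mat (A i) * X i * A i
      + transpose_mat (A i) * X i * B i * H i * transpose_mat (B i) * X i * A i + S i)"
    by (rule block_diag_cong) (use eq in \<open>simp only: G_def H_def\<close>)
  also have "\<dots> = transpose_mat (?D A) * ?D X * ?D A
      + transpose_mat (?D A) * ?D X * ?D B * minv (gap (m * d) (?D B) \<gamma> (?D X)) * transpose_mat (?D B) * ?D X * ?D A
      + ?D S"
    unfolding minv by (simp add: simps)
  finally have "riccati_solution (n * d) (m * d) (?D A) (?D B) (?D S) \<gamma> (?D X)"
    unfolding riccati_solution_def using inv_gap X by (auto intro!: block_diag_carrier)
  moreover have "transpose_mat (?D X) = ?D X" by (simp add: simps sym cong: block_diag_cong)
  moreover have "rho (closed_loop (m * d) (?D A) (?D B) \<gamma> (?D X)) < 1"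
    unfolding cl using rho(2) cl_c n d by (subst rho_block_diag[of _ _ n]) auto
  moreover have "rho (?D A + (1 / \<gamma>\<^sup>2) \<cdot>\<^sub>m (?D B * transpose_mat (?D B) * ?D X)) < 1"
    unfolding pert using rho(1) n d by (subst rho_block_diag[of _ _ n]) (auto simp: dims)
  ultimately show ?thesis by (simp add: stabilizing_solution_def)
qed

section \<open>The equation of size two\<close>

lemma carrier_mat_2I: "mat_of_rows_list 2 [[a, b], [c, e]] \<in> carrier_mat 2 2"
  by (simp add: mat_of_rows_list_def carrier_matI)

lemma mat_2_eqI:
  assumes "X \<in> carrier_mat 2 2" "Y \<in> carrier_mat 2 2"
    "X $$ (0, 0) = Y $$ (0, 0)" "X $$ (0, 1) = Y $$ (0, 1)"
    "X $$ (1, 0) = Y $$ (1, 0)" "X $$ (1, 1) = Y $$ (1, 1)"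
  shows "X = Y"
proof (rule eq_matI)
  fix i j assume "i < dim_row Y" "j < dim_col Y"
  then have "(i = 0 \<or> i = 1) \<and> (j = 0 \<or> j = 1)" using assms by auto
  then show "X $$ (i, j) = Y $$ (i, j)" using assms by auto
qed (use assms in auto)

lemma det_2:
  assumes A: "A \<in> carrier_mat 2 2"
  shows "det A = A $$ (0, 0) * A $$ (1, 1) - A $$ (0, 1) * A $$ (1, 0)"
  using A by (subst laplace_expansion_column[OF A, of 0])
    (auto simp: numeral_2_eq_2 cofactor_def det_single mat_delete_def)

lemma char_poly_2:
  fixes M :: "'a :: idom mat"
  assumes M: "M \<in> carrier_mat 2 2"
  shows "char_poly M = [: M $$ (0, 0) * M $$ (1, 1) - M $$ (0, 1) * M $$ (1, 0),
     - (M $$ (0, 0) + M $$ (1, 1)), 1 :]"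
proof -
  have "char_poly_matrix M \<in> carrier_mat 2 2" using M by simp
  from det_2[OF this] show ?thesis
    using M by (simp add: char_poly_def char_poly_matrix_def algebra_simps)
qed

section \<open>Stability of real quadratics\<close>

text \<open>The Schur-Cohn (Jury) criterion in degree two. Nonreal roots have squared modulus
  \<open>c\<close>; for real ones the values at 1 and -1 and the product \<open>c\<close> of the
  roots decide.\<close>

lemma quadratic_roots_unit_disc:
  fixes b c :: real
  shows "(\<forall>z. z\<^sup>2 + complex_of_real b * z + complex_of_real c = 0 \<longrightarrow> cmod z < 1)
    \<longleftrightarrow> \<bar>c\<bar> < 1 \<and> \<bar>b\<bar> < 1 + c"
proof
  assume *: "\<bar>c\<bar> < 1 \<and> \<bar>b\<bar> < 1 + c"
  show "\<forall>z. z\<^sup>2 + complex_of_real b * z + complex_of_real c = 0 \<longrightarrow> cmod z < 1"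
  proof (intro allI impI)
    fix z :: complex
    assume z: "z\<^sup>2 + complex_of_real b * z + complex_of_real c = 0"
    define s t where "s = Re z" and "t = Im z"
    have re: "s\<^sup>2 - t\<^sup>2 + b * s + c = 0" and im: "2 * s * t + b * t = 0"
      using arg_cong[OF z, of Re] arg_cong[OF z, of Im]
      by (auto simp: s_def t_def power2_eq_square mult_ac)
    have nz: "(cmod z)\<^sup>2 = s\<^sup>2 + t\<^sup>2" by (simp add: cmod_power2 s_def t_def)
    show "cmod z < 1"
    proof (cases "t = 0")
      case True
      then have re: "s\<^sup>2 + b * s + c = 0" using re by simp
      have "\<bar>s\<bar> < 1"
      proof (rule ccontr)
        assume "\<not> \<bar>s\<bar> < 1"
        then have s: "1 \<le> \<bar>s\<bar>" by simp
        have "\<bar>b * s\<bar> < (1 + c) * \<bar>s\<bar>"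
          unfolding abs_mult using * s by (intro mult_strict_right_mono) auto
        \<comment> \<open>Expanded, \<open>s^2 + c\<close> is at least \<open>(1 + c) * |s|\<close>,
          which exceeds \<open>|b * s|\<close>.\<close>
        moreover have "0 \<le> (\<bar>s\<bar> - 1) * (\<bar>s\<bar> - c)" using * s by (intro mult_nonneg_nonneg) auto
        ultimately have "0 < s\<^sup>2 + b * s + c"
          by (auto simp: algebra_simps abs_if power2_eq_square split: if_splits)
        then show False using re by simp
      qed
      then show ?thesis using True by (simp add: cmod_def s_def[symmetric] t_def[symmetric])
    next
      case False
      \<comment> \<open>A nonreal root has real part \<open>- b / 2\<close>; the equation of real
        parts then leaves \<open>c\<close> as its squared modulus.\<close>
      have "(2 * s + b) * t = 0" using im by (simp add: algebra_simps)
      then have "b = - 2 * s" using False by simp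
      then have "(cmod z)\<^sup>2 = c" using re nz by (simp add: power2_eq_square)
      then have "(cmod z)\<^sup>2 < 1\<^sup>2" using * by (simp add: abs_less_iff)
      then show ?thesis by (rule power_less_imp_less_base) simp
    qed
  qed
next
  assume *: "\<forall>z. z\<^sup>2 + complex_of_real b * z + complex_of_real c = 0 \<longrightarrow> cmod z < 1"
  have real_root: "\<bar>s\<bar> < 1" if "s\<^sup>2 + b * s + c = 0" for s
  proof -
    have "(complex_of_real s)\<^sup>2 + complex_of_real b * complex_of_real s + complex_of_real c
      = complex_of_real (s\<^sup>2 + b * s + c)" by simp
    then show ?thesis using * that by (metis norm_of_real of_real_0)
  qed
  have roots: "((- b + sqrt (b\<^sup>2 - 4 * c)) / 2)\<^sup>2 + b * ((- b + sqrt (b\<^sup>2 - 4 * c)) / 2) + c = 0"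
      "((- b - sqrt (b\<^sup>2 - 4 * c)) / 2)\<^sup>2 + b * ((- b - sqrt (b\<^sup>2 - 4 * c)) / 2) + c = 0"
    if "0 \<le> b\<^sup>2 - 4 * c"
    using that by (auto simp: power2_sum power2_diff field_simps power2_eq_square)
  \<comment> \<open>Otherwise the quadratic is nonpositive at 1 and its larger real root is at least
    1; the next bound is the mirror image at -1.\<close>
  have "-b < 1 + c"
  proof (rule ccontr)
    assume "\<not> -b < 1 + c"
    then have "(b + 2)\<^sup>2 \<le> b\<^sup>2 - 4 * c" by (simp add: power2_eq_square algebra_simps)
    moreover from this have D: "0 \<le> b\<^sup>2 - 4 * c" by (meson order_trans zero_le_power2)
    ultimately have "b + 2 \<le> sqrt (b\<^sup>2 - 4 * c)" by (simp add: real_le_rsqrt)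
    then show False using real_root[OF roots(1)[OF D]] by simp
  qed
  moreover have "b < 1 + c"
  proof (rule ccontr)
    assume "\<not> b < 1 + c"
    then have "(2 - b)\<^sup>2 \<le> b\<^sup>2 - 4 * c" by (simp add: power2_eq_square algebra_simps)
    moreover from this have D: "0 \<le> b\<^sup>2 - 4 * c" by (meson order_trans zero_le_power2)
    ultimately have "2 - b \<le> sqrt (b\<^sup>2 - 4 * c)" by (simp add: real_le_rsqrt)
    then show False using real_root[OF roots(2)[OF D]] by simp
  qed
  \<comment> \<open>The product of the roots is \<open>c\<close>; for a conjugate pair it is the
    squared modulus.\<close>
  moreover have "c < 1"
  proof (cases "0 \<le> b\<^sup>2 - 4 * c")
    case True
    let ?s = "(- b + sqrt (b\<^sup>2 - 4 * c)) / 2" and ?t = "(- b - sqrt (b\<^sup>2 - 4 * c)) / 2"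
    have "\<bar>?s\<bar> < 1" "\<bar>?t\<bar> < 1" using real_root roots[OF True] by blast+
    then have "\<bar>?s\<bar> * \<bar>?t\<bar> < 1 * 1" by (intro mult_strict_mono') auto
    moreover have "?s * ?t = c" using True by (simp add: field_simps power2_eq_square)
    ultimately show ?thesis by (metis abs_mult abs_less_iff mult_1)
  next
    case False
    define z where "z = Complex (- b / 2) (sqrt (4 * c - b\<^sup>2) / 2)"
    have sq: "(sqrt (4 * c - b\<^sup>2))\<^sup>2 = 4 * c - b\<^sup>2" using False by simp
    have "z\<^sup>2 + complex_of_real b * z + complex_of_real c = 0"
      using sq by (intro complex_eqI) (auto simp: z_def power2_eq_square field_simps)
    then have "cmod z < 1" using * by blast
    then have "(cmod z)\<^sup>2 < 1" by (simp add: power_less_one_iff)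
    moreover have "(cmod z)\<^sup>2 = c" using sq by (simp add: cmod_power2 z_def power_divide diff_divide_distrib)
    ultimately show ?thesis by simp
  qed
  ultimately show "\<bar>c\<bar> < 1 \<and> \<bar>b\<bar> < 1 + c" by linarith
qed

lemma rho_2_less_1_iff:
  assumes M: "M \<in> carrier_mat 2 2"
    and b: "b = - (M $$ (0, 0) + M $$ (1, 1))"
    and c: "c = M $$ (0, 0) * M $$ (1, 1) - M $$ (0, 1) * M $$ (1, 0)"
  shows "rho M < 1 \<longleftrightarrow> \<bar>c\<bar> < 1 \<and> \<bar>b\<bar> < 1 + c"
proof -
  have "char_poly M = [:c, b, 1:]" using char_poly_2[OF M] b c by simp
  then show ?thesis
    using rho_less_1_iff[OF M] quadratic_roots_unit_disc[of b c]
    by (simp add: algebra_simps power2_eq_square)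
qed

section \<open>Spectral factorization on the unit circle\<close>

text \<open>The coefficients \<open>b'\<close>, \<open>c'\<close> below belong to the stable spectral factor:
  on the unit circle \<open>\<bar>z\<^sup>2 + b z + c\<bar>\<^sup>2 - \<epsilon> = r \<bar>z\<^sup>2 + b' z + c'\<bar>\<^sup>2\<close>. In terms of \<open>w = (r + c)\<^sup>2 / r\<close>
  the factorization amounts to \<open>w + m\<^sup>2 / w = (1 + c)\<^sup>2 + b\<^sup>2 - \<epsilon>\<close> with \<open>m = \<bar>b\<bar> (1 + c)\<close>, and stability
  selects the larger roots \<open>w\<close> and \<open>r\<close>.\<close>

lemma spectral_factor:
  fixes b c e :: real
  assumes c: "\<bar>c\<bar> < 1" and b: "\<bar>b\<bar> < 1 + c" and e: "0 < e"
    and e1: "c > 0 \<and> \<bar>b\<bar> * (1 + c) < 4 * c \<Longrightarrow> e < (1 - c)\<^sup>2 * (1 - b\<^sup>2 / (4 * c))"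
    and e2: "\<not> (c > 0 \<and> \<bar>b\<bar> * (1 + c) < 4 * c) \<Longrightarrow> e < (1 + c - \<bar>b\<bar>)\<^sup>2"
  obtains r where "\<bar>c\<bar> < r" "r < 1" "\<bar>b\<bar> * (1 + c) * r < (r + c)\<^sup>2"
    "r + c\<^sup>2 / r + b\<^sup>2 * (1 + c)\<^sup>2 * r / (r + c)\<^sup>2 = 1 + b\<^sup>2 + c\<^sup>2 - e"
proof -
  define m where "m = \<bar>b\<bar> * (1 + c)"
  define E where "E = (1 + c)\<^sup>2 + b\<^sup>2 - e"
  have m: "0 \<le> m" "m < (1 + c)\<^sup>2"
    using b c by (auto simp: m_def power2_eq_square intro!: mult_strict_right_mono)
  \<comment> \<open>The left side is \<open>w + m^2 / w\<close> at \<open>w = 4 * c\<close>; the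
    bound later forces \<open>w\<close> past \<open>4 * c\<close>, where \<open>r\<close> is
    real.\<close>
  have E4: "4 * c + m\<^sup>2 / (4 * c) < E" if "c > 0" "m < 4 * c"
  proof -
    have "e < (1 - c)\<^sup>2 * (1 - b\<^sup>2 / (4 * c))" using that e1 by (simp add: m_def)
    also have "\<dots> = (1 - c)\<^sup>2 + b\<^sup>2 - m\<^sup>2 / (4 * c)"
      using that(1) by (simp add: m_def field_simps power2_eq_square)
    finally show ?thesis by (simp add: E_def power2_eq_square algebra_simps)
  qed
  \<comment> \<open>By AM-GM, \<open>w + m^2 / w\<close> is at least \<open>2 * m\<close>; a
    strictly larger \<open>E\<close> gives two distinct real roots \<open>w\<close>. In the second
    case \<open>E - 2 * m\<close> is \<open>(1 + c - |b|)^2 - e\<close>.\<close>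
  have E2: "2 * m < E"
  proof (cases "c > 0 \<and> m < 4 * c")
    case True
    have "0 \<le> (4 * c - m)\<^sup>2 / (4 * c)" using True by simp
    also have "\<dots> = 4 * c + m\<^sup>2 / (4 * c) - 2 * m" using True by (simp add: field_simps power2_eq_square)
    finally show ?thesis using E4 True by linarith
  next
    case False
    then have "e < (1 + c - \<bar>b\<bar>)\<^sup>2" using e2 by (simp add: m_def)
    moreover have "\<bar>b\<bar> * \<bar>b\<bar> = b\<^sup>2" by (simp add: power2_eq_square)
    ultimately show ?thesis by (simp add: E_def m_def power2_eq_square algebra_simps)
  qed
  \<comment> \<open>The larger root of \<open>w^2 - E w + m^2\<close>, hence above \<open>m\<close>,
    where \<open>w + m^2 / w\<close> increases.\<close>
  define w where "w = (E + sqrt (E\<^sup>2 - 4 * m\<^sup>2)) / 2"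
  have disc: "0 < E\<^sup>2 - 4 * m\<^sup>2"
  proof -
    have "(2 * m)\<^sup>2 < E\<^sup>2" using E2 m by (intro power_strict_mono) auto
    then show ?thesis by (simp add: power_mult_distrib)
  qed
  have wq: "w\<^sup>2 - E * w + m\<^sup>2 = 0"
    using disc by (simp add: w_def field_simps power2_eq_square)
  have wE: "E < 2 * w" using disc by (simp add: w_def)
  have wm: "m < w" using wE E2 by simp
  have w0: "0 < w" using wm m by simp
  have weq: "w + m\<^sup>2 / w = E" using wq w0 by (simp add: field_simps power2_eq_square)
  \<comment> \<open>Makes the discriminant of the quadratic for \<open>r\<close> positive. In the
    first case \<open>w \<le> 4 * c\<close> would contradict \<open>E4\<close> by monotonicity of
    \<open>w + m^2 / w\<close> beyond \<open>m\<close>.\<close>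
  have w4: "4 * c < w"
  proof (cases "c > 0 \<and> m < 4 * c")
    case True
    show ?thesis
    proof (rule ccontr)
      assume "\<not> ?thesis"
      then have "w \<le> 4 * c" by simp
      moreover have "m * m \<le> w * (4 * c)" using wm m True by (intro mult_mono) auto
      ultimately have "0 \<le> (4 * c - w) * (w * (4 * c) - m\<^sup>2)"
        by (intro mult_nonneg_nonneg) (auto simp: power2_eq_square)
      then have "0 \<le> (4 * c - w) * (w * (4 * c) - m\<^sup>2) / (w * (4 * c))" using w0 True by simp
      also have "\<dots> = 4 * c + m\<^sup>2 / (4 * c) - (w + m\<^sup>2 / w)"
        using w0 True by (simp add: field_simps power2_eq_square)
      finally show False using E4 True weq by simp
    qed
  qed (use wm w0 in auto)
  \<comment> \<open>At \<open>(1 + c)^2\<close> the function \<open>w + m^2 / w\<close> has the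
    value \<open>E + e\<close>, which is too large; monotonicity keeps \<open>w\<close>
    below.\<close>
  have w1: "w < (1 + c)\<^sup>2"
  proof (rule ccontr)
    assume "\<not> ?thesis"
    then have *: "(1 + c)\<^sup>2 \<le> w" by simp
    have c1: "0 < (1 + c)\<^sup>2" using c by simp
    have "m * m \<le> w * (1 + c)\<^sup>2" using wm m by (intro mult_mono) auto
    then have "0 \<le> (w - (1 + c)\<^sup>2) * (w * (1 + c)\<^sup>2 - m\<^sup>2) / (w * (1 + c)\<^sup>2)"
      using * w0 by (intro divide_nonneg_nonneg mult_nonneg_nonneg) (auto simp: power2_eq_square)
    also have "\<dots> = (w + m\<^sup>2 / w) - ((1 + c)\<^sup>2 + m\<^sup>2 / (1 + c)\<^sup>2)"
      using w0 c1 by (simp add: field_simps power2_eq_square)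
    also have "m\<^sup>2 / (1 + c)\<^sup>2 = b\<^sup>2" using c1 by (simp add: m_def power_mult_distrib)
    finally show False using weq e by (simp add: E_def)
  qed
  \<comment> \<open>The larger root of \<open>r^2 - (w - 2 * c) * r + c^2\<close>, which is
    \<open>(r + c)^2 = w * r\<close> rearranged.\<close>
  define r where "r = ((w - 2 * c) + sqrt (w * (w - 4 * c))) / 2"
  have d: "0 < w * (w - 4 * c)" using w0 w4 by simp
  have rq: "(r + c)\<^sup>2 = w * r"
  proof -
    have "(sqrt (w * (w - 4 * c)))\<^sup>2 = w * (w - 4 * c)" using d by simp
    then show ?thesis by (simp add: r_def field_simps power2_eq_square)
  qed
  have rc: "\<bar>c\<bar> < r"
  proof -
    have "w - 2 * c < 2 * r" using d by (simp add: r_def)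
    moreover have "c < 0 \<Longrightarrow> ?thesis" using calculation w0 by simp
    ultimately show ?thesis using w4 by linarith
  qed
  have r0: "0 < r" using rc by linarith
  have "r < 1"
  proof (rule ccontr)
    \<comment> \<open>For \<open>r\<close> at least 1,
      \<open>(r - 1) * (r - c^2) = (r + c)^2 - r * (1 + c)^2\<close> would be nonnegative,
      contradicting \<open>w1\<close>.\<close>
    assume "\<not> ?thesis"
    then have "0 \<le> (r - 1) * (r - c\<^sup>2)"
    proof (intro mult_nonneg_nonneg)
      have "c\<^sup>2 \<le> 1" using c by (simp add: abs_square_le_1)
      then show "0 \<le> r - c\<^sup>2" using \<open>\<not> r < 1\<close> by linarith
    qed simp
    then have "r * (1 + c)\<^sup>2 \<le> (r + c)\<^sup>2" by (simp add: power2_eq_square algebra_simps)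
    then have "(1 + c)\<^sup>2 \<le> w" using r0 rq by (simp add: mult.commute)
    then show False using w1 by simp
  qed
  moreover have "\<bar>b\<bar> * (1 + c) * r < (r + c)\<^sup>2" using rq wm r0 by (simp add: m_def)
  moreover have "r + c\<^sup>2 / r + b\<^sup>2 * (1 + c)\<^sup>2 * r / (r + c)\<^sup>2 = 1 + b\<^sup>2 + c\<^sup>2 - e"
  proof -
    have "b\<^sup>2 * (1 + c)\<^sup>2 * r / (r + c)\<^sup>2 = m\<^sup>2 / w"
      unfolding rq using r0 by (simp add: m_def power_mult_distrib)
    moreover have "r + c\<^sup>2 / r = w - 2 * c"
      using rq r0 by (simp add: field_simps power2_eq_square)
    ultimately show ?thesis using weq by (simp add: E_def power2_eq_square algebra_simps)
  qed
  ultimately show ?thesis using that rc by blast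
qed

text \<open>For the solution constructed below, \<open>1 - r\<close> and \<open>b * c * t\<close>
  are the amounts by which \<open>\<gamma>^-2 B B^T X\<close> lowers the coefficients
  \<open>b\<close> and \<open>c\<close>. The claims are the quadratic criterion for
  \<open>A + \<gamma>^-2 B B^T X\<close>; stability of the spectral factor itself concerns only the
  closed loop.\<close>

lemma perturbed_stable:
  fixes b c r :: real
  assumes r: "\<bar>c\<bar> < r" "r < 1" and b: "\<bar>b\<bar> < 1 + c" and br: "\<bar>b\<bar> * (1 + c) * r < (r + c)\<^sup>2"
  defines "t \<equiv> (1 - r) / (r + c)"
  shows "\<bar>c - b * c * t\<bar> < 1" "\<bar>b - (1 - r)\<bar> < 1 + (c - b * c * t)"
proof -
  have r0: "0 < r" and rc: "0 < r + c" and c1: "0 < 1 + c" using r by linarith+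
  have t0: "0 \<le> t" and trc: "t * (r + c) = 1 - r" using r rc by (auto simp: t_def)
  define k where "k = \<bar>b\<bar> * t"
  have k0: "0 \<le> k" using t0 by (simp add: k_def)
  have k: "k * (r * (1 + c)) \<le> (1 - r) * (r + c)"
  proof -
    have "k * (r * (1 + c)) = t * (\<bar>b\<bar> * (1 + c) * r)" by (simp add: k_def)
    also have "\<dots> \<le> t * (r + c)\<^sup>2" using br t0 by (intro mult_left_mono) auto
    also have "\<dots> = (1 - r) * (r + c)" by (simp add: power2_eq_square flip: trc)
    finally show ?thesis .
  qed
  have k1: "k \<le> 1 - r" if "c \<le> 0"
  proof -
    have "r + c \<le> r * (1 + c)" using mult_right_mono_neg[of r 1 c] that r by (simp add: algebra_simps)
    then have "(1 - r) * (r + c) \<le> (1 - r) * (r * (1 + c))" using r by (intro mult_left_mono) auto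
    then have "k * (r * (1 + c)) \<le> (1 - r) * (r * (1 + c))" using k by linarith
    then show ?thesis using r0 c1 by simp
  qed
  \<comment> \<open>As \<open>|b * c * t| = |c| * k\<close>, this keeps the new constant coefficient
    between -1 and 1.\<close>
  have ck: "\<bar>c\<bar> * k < 1 - \<bar>c\<bar>"
  proof (cases "0 \<le> c")
    case True
    have "c * (1 - r) * (r + c) < r * (1 - c) * (1 + c)"
      using r True by (intro mult_strict_mono) (auto simp: algebra_simps)
    moreover have "c * (k * (r * (1 + c))) \<le> c * ((1 - r) * (r + c))"
      using k True by (intro mult_left_mono)
    ultimately have "(c * k) * (r * (1 + c)) < (1 - c) * (r * (1 + c))"
      by (simp add: mult_ac)
    moreover have "0 < r * (1 + c)" using r0 c1 by simp
    ultimately have "c * k < 1 - c" by (simp only: mult_less_cancel_right_pos)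
    then show ?thesis using True by simp
  next
    case False
    have "\<bar>c\<bar> * k \<le> \<bar>c\<bar> * (1 - r)" using k1 False by (intro mult_left_mono) auto
    moreover have "\<bar>c\<bar> * (2 - r) < r * (2 - r)" using r by (intro mult_strict_right_mono) auto
    moreover have "r * (2 - r) \<le> 1" using zero_le_power2[of "1 - r"] by (simp add: power2_eq_square algebra_simps)
    ultimately show ?thesis by (simp add: algebra_simps)
  qed
  have bct: "\<bar>b * c * t\<bar> = \<bar>c\<bar> * k" using t0 by (simp add: k_def abs_mult)
  show "\<bar>c - b * c * t\<bar> < 1" using ck bct by linarith
  \<comment> \<open>The value of the perturbed quadratic at 1; multiplying by \<open>r + c\<close>
    eliminates \<open>t\<close> and leaves the hypothesis \<open>br\<close>.\<close>
  have "0 < r + c + b - b * c * t"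
  proof -
    have "(r + c) * (r + c + b - b * c * t) = (r + c)\<^sup>2 + b * (r + c) - b * c * (t * (r + c))"
      by (simp add: power2_eq_square algebra_simps)
    also have "\<dots> = (r + c)\<^sup>2 + b * (1 + c) * r" unfolding trc by (simp add: algebra_simps)
    also have "\<dots> > 0"
    proof -
      have "\<bar>b * (1 + c) * r\<bar> < (r + c)\<^sup>2" using br r0 c1 by (simp add: abs_mult)
      then show ?thesis by linarith
    qed
    finally show ?thesis using rc by (simp add: zero_less_mult_iff)
  qed
  \<comment> \<open>Added to \<open>b < 1 + c\<close>, this gives positivity at -1.\<close>
  moreover have "b * c * t \<le> 1 - r"
  proof (cases "0 < c")
    case True
    have "b * c \<le> 2 * c" using True b r by (intro mult_right_mono) auto
    then have "b * c * t \<le> (r + c) * t" using r t0 by (intro mult_right_mono) auto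
    then show ?thesis using trc by (simp add: mult.commute)
  next
    case False
    have "b * c * t \<le> \<bar>c\<bar> * k" using bct by simp
    also have "\<dots> \<le> 1 * k" using r k0 by (intro mult_right_mono) auto
    finally show ?thesis using k1 False by simp
  qed
  ultimately show "\<bar>b - (1 - r)\<bar> < 1 + (c - b * c * t)" using b by linarith
qed

section \<open>Constructing the two-by-two solution\<close>

lemmas mat_2_simps = scalar_prod_def mat_of_rows_list_def numeral_2_eq_2

text \<open>Stability makes \<open>1 + c\<close> exceed \<open>|b|\<close> and the radicand
  positive, so squaring removes absolute values and root. The case split becomes the one in
  \<open>spectral_factor\<close>.\<close>

lemma s_tilde_bound:
  assumes c: "\<bar>c_tilde \<alpha> \<beta> \<nu> l\<bar> < 1" and b: "\<bar>b_tilde \<alpha> \<beta> \<nu> l\<bar> < 1 + c_tilde \<alpha> \<beta> \<nu> l"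
  shows "0 < s_tilde \<alpha> \<beta> \<nu> l"
    and "(s_tilde \<alpha> \<beta> \<nu> l)\<^sup>2 =
      (if 0 < c_tilde \<alpha> \<beta> \<nu> l \<and> \<bar>b_tilde \<alpha> \<beta> \<nu> l\<bar> * (1 + c_tilde \<alpha> \<beta> \<nu> l) < 4 * c_tilde \<alpha> \<beta> \<nu> l
       then (1 - c_tilde \<alpha> \<beta> \<nu> l)\<^sup>2 * (1 - (b_tilde \<alpha> \<beta> \<nu> l)\<^sup>2 / (4 * c_tilde \<alpha> \<beta> \<nu> l))
       else (1 + c_tilde \<alpha> \<beta> \<nu> l - \<bar>b_tilde \<alpha> \<beta> \<nu> l\<bar>)\<^sup>2)"
proof -
  define b c where "b = b_tilde \<alpha> \<beta> \<nu> l" and "c = c_tilde \<alpha> \<beta> \<nu> l"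
  have bc: "\<bar>c\<bar> < 1" "\<bar>b\<bar> < 1 + c" using assms by (auto simp: b_def c_def)
  let ?P = "0 < c \<and> \<bar>b\<bar> * (1 + c) < 4 * c"
  have s: "s_tilde \<alpha> \<beta> \<nu> l = (if ?P then \<bar>1 - c\<bar> * sqrt (1 - b\<^sup>2 / (4 * c)) else \<bar>\<bar>1 + c\<bar> - \<bar>b\<bar>\<bar>)"
    by (auto simp: s_tilde_def b_def c_def Let_def)
  have pos: "0 < 1 - b\<^sup>2 / (4 * c)" if ?P
  proof -
    have "\<bar>b\<bar> * \<bar>b\<bar> \<le> \<bar>b\<bar> * (1 + c)" using bc by (intro mult_left_mono) auto
    then have "b\<^sup>2 < 4 * c" using that by (simp add: power2_eq_square)
    then show ?thesis using that by simp
  qed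
  show "0 < s_tilde \<alpha> \<beta> \<nu> l" using s pos bc by (auto split: if_splits)
  have "(s_tilde \<alpha> \<beta> \<nu> l)\<^sup>2 = (if ?P then (1 - c)\<^sup>2 * (1 - b\<^sup>2 / (4 * c)) else (1 + c - \<bar>b\<bar>)\<^sup>2)"
    using s pos bc by (auto simp: power_mult_distrib)
  then show "(s_tilde \<alpha> \<beta> \<nu> l)\<^sup>2 =
      (if 0 < c_tilde \<alpha> \<beta> \<nu> l \<and> \<bar>b_tilde \<alpha> \<beta> \<nu> l\<bar> * (1 + c_tilde \<alpha> \<beta> \<nu> l) < 4 * c_tilde \<alpha> \<beta> \<nu> l
       then (1 - c_tilde \<alpha> \<beta> \<nu> l)\<^sup>2 * (1 - (b_tilde \<alpha> \<beta> \<nu> l)\<^sup>2 / (4 * c_tilde \<alpha> \<beta> \<nu> l))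
       else (1 + c_tilde \<alpha> \<beta> \<nu> l - \<bar>b_tilde \<alpha> \<beta> \<nu> l\<bar>)\<^sup>2)"
    by (simp add: b_def c_def)
qed

text \<open>Companion form of \<open>z^2 + b z + c\<close>, to which the quadratic criterion applies
  directly.\<close>

lemma A_tilde_eq:
  "A_tilde \<alpha> \<beta> \<nu> l = mat_of_rows_list 2 [[- b_tilde \<alpha> \<beta> \<nu> l, - c_tilde \<alpha> \<beta> \<nu> l], [1, 0]]"
  by (simp add: A_tilde_def b_tilde_def c_tilde_def algebra_simps)

lemma tilde_carrier:
  "A_tilde \<alpha> \<beta> \<nu> l \<in> carrier_mat 2 2" "B_tilde \<alpha> \<in> carrier_mat 2 1" "S_tilde l \<in> carrier_mat 2 2"
  by (auto simp: A_tilde_def B_tilde_def S_tilde_def mat_of_rows_list_def)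

lemma rho_A_tilde:
  "rho (A_tilde \<alpha> \<beta> \<nu> l) < 1 \<longleftrightarrow>
    \<bar>c_tilde \<alpha> \<beta> \<nu> l\<bar> < 1 \<and> \<bar>b_tilde \<alpha> \<beta> \<nu> l\<bar> < 1 + c_tilde \<alpha> \<beta> \<nu> l"
  by (rule rho_2_less_1_iff[OF tilde_carrier(1)]) (auto simp: A_tilde_eq mat_of_rows_list_def)

lemma transpose_S_tilde: "transpose_mat (S_tilde l) = S_tilde l"
  by (rule mat_2_eqI) (auto simp: S_tilde_def mat_of_rows_list_def)

lemma gap_tilde:
  assumes "X \<in> carrier_mat 2 2"
  shows "gap 1 (B_tilde \<alpha>) \<gamma> X = mat 1 1 (\<lambda>_. \<gamma>\<^sup>2 - \<alpha>\<^sup>2 * X $$ (0, 0))"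
  using assms by (intro eq_matI)
    (auto simp: gap_def B_tilde_def mat_2_simps power2_eq_square)

lemma minv_gap_tilde:
  assumes X: "X \<in> carrier_mat 2 2" and nz: "\<gamma>\<^sup>2 - \<alpha>\<^sup>2 * X $$ (0, 0) \<noteq> 0"
  shows "invertible_mat (gap 1 (B_tilde \<alpha>) \<gamma> X)"
    "minv (gap 1 (B_tilde \<alpha>) \<gamma> X) = mat 1 1 (\<lambda>_. 1 / (\<gamma>\<^sup>2 - \<alpha>\<^sup>2 * X $$ (0, 0)))"
proof -
  let ?G = "mat 1 1 (\<lambda>_. \<gamma>\<^sup>2 - \<alpha>\<^sup>2 * X $$ (0, 0))"
  let ?H = "mat 1 1 (\<lambda>_. 1 / (\<gamma>\<^sup>2 - \<alpha>\<^sup>2 * X $$ (0, 0)))"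
  have "?G * ?H = 1\<^sub>m 1" "?H * ?G = 1\<^sub>m 1"
    using nz by (auto intro!: eq_matI simp: scalar_prod_def)
  from minv_eqI[OF _ _ this]
  show "invertible_mat (gap 1 (B_tilde \<alpha>) \<gamma> X)" "minv (gap 1 (B_tilde \<alpha>) \<gamma> X) = ?H"
    unfolding gap_tilde[OF X] by auto
qed

text \<open>The stable spectral factor prescribes the closed loop; the entries of \<open>X\<close>
  are recovered from it and then checked against the equation, both stability conditions and
  semidefiniteness.\<close>

lemma stabilizing_2x2_exists:
  assumes \<gamma>: "0 < \<gamma>" and \<alpha>: "0 < \<alpha>" and l: "0 < l"
    and rho: "rho (A_tilde \<alpha> \<beta> \<nu> l) < 1"
    and bound: "\<alpha>\<^sup>2 * l / (2 * \<gamma>\<^sup>2) < (s_tilde \<alpha> \<beta> \<nu> l)\<^sup>2"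
  shows "\<exists>X. stabilizing_2x2 \<alpha> \<beta> \<nu> l \<gamma> X"
proof -
  define b c where "b = b_tilde \<alpha> \<beta> \<nu> l" and "c = c_tilde \<alpha> \<beta> \<nu> l"
  have c: "\<bar>c\<bar> < 1" and b: "\<bar>b\<bar> < 1 + c" using rho by (auto simp: rho_A_tilde b_def c_def)
  define g where "g = \<alpha>\<^sup>2 / \<gamma>\<^sup>2"
  have g: "0 < g" using \<gamma> \<alpha> by (simp add: g_def)
  define e where "e = g * l / 2"
  have e: "0 < e" using g l by (simp add: e_def)
  have es: "e < (s_tilde \<alpha> \<beta> \<nu> l)\<^sup>2" using bound by (simp add: e_def g_def field_simps)
  obtain r where r: "\<bar>c\<bar> < r" "r < 1" "\<bar>b\<bar> * (1 + c) * r < (r + c)\<^sup>2"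
    and fac: "r + c\<^sup>2 / r + b\<^sup>2 * (1 + c)\<^sup>2 * r / (r + c)\<^sup>2 = 1 + b\<^sup>2 + c\<^sup>2 - e"
    using spectral_factor[OF c b e] es s_tilde_bound(2)[OF c[unfolded c_def] b[unfolded b_def c_def]]
    by (auto simp flip: b_def c_def split: if_splits)
  have r0: "0 < r" and rc: "0 < r + c" using r by linarith+
  \<comment> \<open>Comparing Fourier coefficients in \<open>|p|^2 - e = r |p'|^2\<close> gives
    \<open>r c' = c\<close> and \<open>r b' (1 + c') = b (1 + c)\<close>.\<close>
  define b' c' where "b' = b * (1 + c) / (r + c)" and "c' = c / r"
  \<comment> \<open>\<open>x\<close> makes the gap equal to \<open>\<gamma>^2 r\<close>,
    \<open>y\<close> gives the closed loop the trace \<open>- b'\<close>, and \<open>w\<close>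
    solves the lower right entry of the equation.\<close>
  define x y where "x = (1 - r) / g" and "y = c * (b' - b) / g"
  define w where "w = c * c' * x"
  define X where "X = mat_of_rows_list 2 [[x, y], [y, w]]"
  let ?A = "A_tilde \<alpha> \<beta> \<nu> l" and ?B = "B_tilde \<alpha>"
  let ?H = "minv (gap 1 ?B \<gamma> X)"
  have A: "?A = mat_of_rows_list 2 [[- b, - c], [1, 0]]" by (simp add: A_tilde_eq b_def c_def)
  have X: "X \<in> carrier_mat 2 2" by (simp add: X_def carrier_mat_2I)
  have gx: "g * x = 1 - r" using g by (simp add: x_def)
  have x: "0 < x" using g r by (simp add: x_def)
  have db: "b' - b = b * (1 - r) / (r + c)" using rc by (simp add: b'_def field_simps)
  have gy: "g * y = b * c * (1 - r) / (r + c)" using g db by (simp add: y_def mult_ac)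
  have y: "y = b * c * x / (r + c)" unfolding y_def db x_def by (simp add: mult_ac)
  have u: "y - b * x = - b * r * x / (r + c)" using rc by (simp add: y field_simps)
  have "\<alpha>\<^sup>2 * x = \<gamma>\<^sup>2 * (1 - r)"
    using gx \<gamma> by (simp add: g_def field_simps)
  then have gap0: "\<gamma>\<^sup>2 - \<alpha>\<^sup>2 * X $$ (0, 0) = \<gamma>\<^sup>2 * r"
    by (simp add: X_def mat_of_rows_list_def algebra_simps)
  then have nz: "\<gamma>\<^sup>2 - \<alpha>\<^sup>2 * X $$ (0, 0) \<noteq> 0" using \<gamma> r0 by simp
  have inv: "invertible_mat (gap 1 ?B \<gamma> X)" and H: "?H = mat 1 1 (\<lambda>_. 1 / (\<gamma>\<^sup>2 * r))"
    using minv_gap_tilde[OF X nz] by (simp_all add: gap0)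
  have ah: "\<alpha> * \<alpha> / (\<gamma>\<^sup>2 * r) = g / r" by (simp add: g_def power2_eq_square)
  have eq11: "w = c\<^sup>2 * x + g / r * (c * x)\<^sup>2"
  proof -
    have "c\<^sup>2 * x + g / r * (c * x)\<^sup>2 = c\<^sup>2 * x * (1 + g * x / r)" by (simp add: power2_eq_square algebra_simps)
    also have "\<dots> = w" using r0 unfolding gx by (simp add: w_def c'_def field_simps power2_eq_square)
    finally show ?thesis by simp
  qed
  have eq01: "y = - c * (y - b * x) - g / r * (c * x * (y - b * x))"
  proof -
    have "- c * (y - b * x) - g / r * (c * x * (y - b * x)) = - c * (y - b * x) * (1 + g * x / r)"
      by (simp add: algebra_simps)
    also have "\<dots> = y" using r0 rc unfolding gx u by (simp add: y field_simps)
    finally show ?thesis by simp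
  qed
  \<comment> \<open>Multiplied by \<open>g\<close>, this entry is the constant Fourier coefficient
    of the factorization; here \<open>fac\<close> enters.\<close>
  have eq00: "x = b\<^sup>2 * x - 2 * b * y + w + g / r * (y - b * x)\<^sup>2 + l / 2"
  proof -
    have "g * (b\<^sup>2 * x - 2 * b * y + w + g / r * (y - b * x)\<^sup>2 + l / 2)
      = b\<^sup>2 * (g * x) - 2 * b * (g * y) + c\<^sup>2 / r * (g * x) + r * b\<^sup>2 * (g * x)\<^sup>2 / (r + c)\<^sup>2 + e"
      using r0 rc unfolding u w_def c'_def e_def by (simp add: field_simps power2_eq_square)
    also have "\<dots> = 1 - r"
    proof -
      have e: "e = 1 + b\<^sup>2 + c\<^sup>2 - (r + c\<^sup>2 / r + b\<^sup>2 * (1 + c)\<^sup>2 * r / (r + c)\<^sup>2)" using fac by simp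
      show ?thesis unfolding gx gy e using r0 rc by (simp add: divide_simps) (simp add: algebra_simps power2_eq_square)
    qed
    also have "\<dots> = g * x" by (simp add: gx)
    finally show ?thesis using g by simp
  qed
  have XA: "transpose_mat ?A * X = mat_of_rows_list 2 [[y - b * x, w - b * y], [- c * x, - c * y]]"
    by (rule mat_2_eqI) (auto simp: A X_def mat_2_simps)
  have XAA: "transpose_mat ?A * X * ?A
    = mat_of_rows_list 2 [[- b * (y - b * x) + (w - b * y), - c * (y - b * x)], [b * c * x - c * y, c\<^sup>2 * x]]"
    unfolding XA by (rule mat_2_eqI) (auto simp: A mat_2_simps power2_eq_square)
  have F: "?B * ?H * transpose_mat ?B * X * ?A = mat_of_rows_list 2 [[g / r * (y - b * x), - (g / r * c * x)], [0, 0]]"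
    unfolding H ah[symmetric]
    by (rule mat_2_eqI) (auto simp: A B_tilde_def X_def mat_2_simps algebra_simps diff_divide_distrib)
  have G: "transpose_mat ?A * X * ?B * ?H * transpose_mat ?B * X * ?A = 
    mat_of_rows_list 2 [[g / r * (y - b * x)\<^sup>2, - (g / r * (c * x * (y - b * x)))], [- (g / r * (c * x * (y - b * x))), g / r * (c * x)\<^sup>2]]"
    unfolding XA H ah[symmetric]
    by (rule mat_2_eqI) (auto simp: A B_tilde_def X_def mat_2_simps algebra_simps power2_eq_square diff_divide_distrib)
  have eq: "X = transpose_mat ?A * X * ?A + transpose_mat ?A * X * ?B * ?H * transpose_mat ?B * X * ?A + S_tilde l"
    unfolding XAA G
    by (rule mat_2_eqI; simp add: X_def S_tilde_def mat_of_rows_list_def)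
      (use eq00 eq01 eq11 in \<open>auto simp: algebra_simps power2_eq_square add_divide_distrib diff_divide_distrib\<close>)
  have sym: "transpose_mat X = X" by (rule mat_2_eqI) (auto simp: X_def mat_of_rows_list_def)
  have sol: "riccati_solution 2 1 ?A ?B (S_tilde l) \<gamma> X"
    unfolding riccati_solution_def using X inv eq by blast
  have "g / r * (y - b * x) = - (b' - b)"
  proof -
    have "g / r * (y - b * x) = - b * (g * x) / (r + c)" unfolding u using r0 by simp
    then show ?thesis unfolding gx db by simp
  qed
  moreover have "g / r * c * x = c' - c"
  proof -
    have "g / r * c * x = c * (g * x) / r" by simp
    then show ?thesis unfolding gx c'_def using r0 by (simp add: field_simps)
  qed
  ultimately have cl: "closed_loop 1 ?A ?B \<gamma> X = mat_of_rows_list 2 [[- b', - c'], [1, 0]]"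
    unfolding closed_loop_def F by (intro mat_2_eqI) (auto simp: A mat_of_rows_list_def)
  \<comment> \<open>The bounds \<open>|c| < r\<close> and \<open>|b| (1 + c) r < (r + c)^2\<close>
    translate into stability of \<open>z^2 + b' z + c'\<close>.\<close>
  have "\<bar>c'\<bar> < 1" using r r0 by (simp add: c'_def)
  moreover have "\<bar>b'\<bar> < 1 + c'"
  proof -
    have "\<bar>b'\<bar> = \<bar>b\<bar> * (1 + c) / (r + c)" using rc c by (simp add: b'_def abs_mult)
    also have "\<dots> < (r + c) / r" using r0 rc r(3) by (simp add: divide_simps power2_eq_square)
    also have "\<dots> = 1 + c'" using r0 by (simp add: c'_def field_simps)
    finally show ?thesis .
  qed
  ultimately have rho_cl: "rho (closed_loop 1 ?A ?B \<gamma> X) < 1"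
    unfolding cl by (subst rho_2_less_1_iff[OF carrier_mat_2I refl refl]) (simp add: mat_of_rows_list_def)
  have P: "?A + (1 / \<gamma>\<^sup>2) \<cdot>\<^sub>m (?B * transpose_mat ?B * X)
    = mat_of_rows_list 2 [[- (b - g * x), - (c - g * y)], [1, 0]]"
    by (rule mat_2_eqI) (auto simp: A B_tilde_def X_def mat_2_simps g_def power2_eq_square)
  have "rho (?A + (1 / \<gamma>\<^sup>2) \<cdot>\<^sub>m (?B * transpose_mat ?B * X)) < 1"
    unfolding P using perturbed_stable[OF r(1,2) b r(3)]
    by (subst rho_2_less_1_iff[OF carrier_mat_2I refl refl]) (simp add: mat_of_rows_list_def gx gy)
  with sol sym rho_cl have "stabilizing_solution 2 1 ?A ?B (S_tilde l) \<gamma> X"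
    by (simp add: stabilizing_solution_def)
  moreover have "0 \<le> v \<bullet> (X *\<^sub>v v)" if v: "v \<in> carrier_vec 2" for v
  proof -
    \<comment> \<open>Yields a nonnegative determinant of \<open>X\<close>, which is
      \<open>(c * x)^2 * (1 / r - b^2 / (r + c)^2)\<close>; with \<open>0 < x\<close>
      semidefiniteness follows.\<close>
    have "b\<^sup>2 * r \<le> (r + c)\<^sup>2"
    proof -
      have "\<bar>b\<bar> * \<bar>b\<bar> * r \<le> \<bar>b\<bar> * (1 + c) * r"
        using b r0 by (intro mult_right_mono mult_left_mono) auto
      then show ?thesis using r(3) by (simp add: power2_eq_square)
    qed
    then have "0 \<le> (c * x)\<^sup>2 * ((r + c)\<^sup>2 - b\<^sup>2 * r) / (r * (r + c)\<^sup>2)" using r0 by simp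
    also have "\<dots> = (c * x)\<^sup>2 * (1 / r - b\<^sup>2 / (r + c)\<^sup>2)"
      using r0 rc by (simp add: diff_frac_eq)
    also have "\<dots> = x * w - y\<^sup>2"
      by (simp add: w_def c'_def y power_divide power_mult_distrib algebra_simps power2_eq_square)
    finally have det: "0 \<le> x * w - y\<^sup>2" .
    have "v \<bullet> (X *\<^sub>v v) = x * (v $ 0)\<^sup>2 + 2 * y * v $ 0 * v $ 1 + w * (v $ 1)\<^sup>2"
      using v by (auto simp: X_def mat_2_simps power2_eq_square algebra_simps)
    \<comment> \<open>Multiplying by \<open>x > 0\<close> completes the square, with the determinant
      as remainder.\<close>
    also have "x * \<dots> = (x * v $ 0 + y * v $ 1)\<^sup>2 + (x * w - y\<^sup>2) * (v $ 1)\<^sup>2"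
      by (simp add: power2_eq_square algebra_simps)
    also have "\<dots> \<ge> 0" using det by simp
    finally show ?thesis using x by (simp add: zero_le_mult_iff)
  qed
  ultimately show ?thesis using X sym
    unfolding stabilizing_2x2_def pos_semidef_def by blast
qed

section \<open>Block diagonalization\<close>

lemma perm_pi_less: "i < 2 * d \<Longrightarrow> perm_pi d i < 2 * d"
  by (auto simp: perm_pi_def)

lemma perm_pi_eq_iff: "i < 2 * d \<Longrightarrow> j < 2 * d \<Longrightarrow> perm_pi d i = perm_pi d j \<longleftrightarrow> i = j"
  unfolding perm_pi_def by presburger

text \<open>In the direct sum, the quotient by 2 names the block and the remainder the position
  inside it.\<close>

lemma perm_pi_div_mod:
  "perm_pi d i div 2 = (if i < d then i else i - d)"
  "perm_pi d i mod 2 = (if i < d then 0 else 1)"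
  by (auto simp: perm_pi_def)

lemma Sigma_carrier: "Sigma_mat d \<in> carrier_mat (2 * d) (2 * d)"
  by (simp add: Sigma_mat_def)

lemma Sigma_mult:
  assumes N: "N \<in> carrier_mat (2 * d) c"
  shows "Sigma_mat d * N = mat (2 * d) c (\<lambda>(i, j). N $$ (perm_pi d i, j))"
proof (rule eq_matI)
  fix i j assume "i < dim_row (mat (2 * d) c (\<lambda>(i, j). N $$ (perm_pi d i, j)))"
    "j < dim_col (mat (2 * d) c (\<lambda>(i, j). N $$ (perm_pi d i, j)))"
  then have ij: "i < 2 * d" "j < c" by auto
  have "(Sigma_mat d * N) $$ (i, j) =
      (\<Sum>k = 0..<2 * d. (if k = perm_pi d i then 1 else 0) * N $$ (k, j))"
    using ij N by (auto simp: Sigma_mat_def scalar_prod_def intro!: sum.cong)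
  also have "\<dots> = (\<Sum>k = 0..<2 * d. if k = perm_pi d i then N $$ (k, j) else 0)"
    by (intro sum.cong) auto
  also have "\<dots> = N $$ (perm_pi d i, j)"
    using perm_pi_less[OF ij(1)] by simp
  finally show "(Sigma_mat d * N) $$ (i, j)
      = mat (2 * d) c (\<lambda>(i, j). N $$ (perm_pi d i, j)) $$ (i, j)"
    using ij by simp
qed (use N in \<open>auto simp: Sigma_mat_def\<close>)

text \<open>The row rule \<open>Sigma_mult\<close> is applied twice, the second time to the
  transpose.\<close>

lemma Sigma_conj:
  assumes N: "N \<in> carrier_mat (2 * d) (2 * d)"
  shows "Sigma_mat d * N * transpose_mat (Sigma_mat d)
    = mat (2 * d) (2 * d) (\<lambda>(i, j). N $$ (perm_pi d i, perm_pi d j))"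
proof -
  let ?S = "Sigma_mat d"
  have "?S * N * transpose_mat ?S = transpose_mat (?S * (transpose_mat (?S * N)))"
    using N Sigma_carrier[of d] by (simp add: mat_transposes)
  also have "\<dots> = mat (2 * d) (2 * d) (\<lambda>(i, j). N $$ (perm_pi d i, perm_pi d j))"
    using N by (subst Sigma_mult[of "transpose_mat _" _ "2 * d"])
      (auto simp: Sigma_mult[OF N] perm_pi_less intro!: eq_matI)
  finally show ?thesis .
qed

text \<open>Conjugation fixes the identity because \<open>perm_pi\<close> is injective; a one-sided
  inverse of a square matrix is two-sided.\<close>

lemma orthonormal_Sigma: "orthonormal (2 * d) (Sigma_mat d)"
proof -
  have "Sigma_mat d * 1\<^sub>m (2 * d) * transpose_mat (Sigma_mat d) = 1\<^sub>m (2 * d)"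
    by (subst Sigma_conj) (auto intro!: eq_matI simp: perm_pi_less perm_pi_eq_iff)
  then have "Sigma_mat d * transpose_mat (Sigma_mat d) = 1\<^sub>m (2 * d)"
    using Sigma_carrier[of d] by simp
  then show ?thesis
    using mat_mult_left_right_inverse[of "Sigma_mat d" "2 * d" "transpose_mat (Sigma_mat d)"] Sigma_carrier[of d]
    by (auto simp: orthonormal_def)
qed

lemma orthonormal_mult:
  assumes "orthonormal n P" "orthonormal n W"
  shows "orthonormal n (P * W)"
proof -
  note simps = orthonormal_dims[OF assms(1)] orthonormal_dims[OF assms(2)]
    orthonormal_cancel[OF assms(1)] orthonormal_cancel[OF assms(2)] mat_transposes mat_mult_assoc
  have "transpose_mat (P * W) * (P * W) = 1\<^sub>m n" "P * W * transpose_mat (P * W) = 1\<^sub>m n"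
    by (simp_all add: simps)
  moreover have "P * W \<in> carrier_mat n n" using assms by (auto simp: orthonormal_def)
  ultimately show ?thesis unfolding orthonormal_def by blast
qed

lemma orthonormal_four_block:
  assumes U: "orthonormal d U"
  shows "orthonormal (2 * d) (four_block_mat U (0\<^sub>m d d) (0\<^sub>m d d) U)"
proof -
  let ?V = "four_block_mat U (0\<^sub>m d d) (0\<^sub>m d d) U"
  have c: "U \<in> carrier_mat d d" "transpose_mat U \<in> carrier_mat d d" using U by (auto simp: orthonormal_def)
  have t: "transpose_mat ?V = four_block_mat (transpose_mat U) (0\<^sub>m d d) (0\<^sub>m d d) (transpose_mat U)"
    using c by (subst transpose_four_block_mat[of _ d d _ d _ d]) auto
  have one: "four_block_mat (1\<^sub>m d) (0\<^sub>m d d) (0\<^sub>m d d) (1\<^sub>m d) = (1\<^sub>m (2 * d) :: real mat)"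
    by (intro eq_matI) auto
  have "transpose_mat ?V * ?V = 1\<^sub>m (2 * d)" "?V * transpose_mat ?V = 1\<^sub>m (2 * d)"
    unfolding t mult_diag_four_block_mat[OF c(1,2,1,2)] mult_diag_four_block_mat[OF c(2,1,2,1)]
      orthonormal_cancel[OF U] by (rule one)+
  moreover have "?V \<in> carrier_mat (2 * d) (2 * d)"
    using carrier_matD[OF c(1)] by (intro carrier_matI) simp_all
  ultimately show ?thesis unfolding orthonormal_def by blast
qed

lemma Y_mat_eq:
  "U \<in> carrier_mat d d \<Longrightarrow> Y_mat d U = four_block_mat U (0\<^sub>m d d) (0\<^sub>m d d) U * Sigma_mat d"
proof -
  assume U: "U \<in> carrier_mat d d"
  \<comment> \<open>The recursion of \<open>diag_block_mat\<close> ends in an empty block, absorbed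
    here.\<close>
  then have "four_block_mat U (0\<^sub>m d 0) (0\<^sub>m 0 d) (0\<^sub>m 0 0) = U"
    by (intro eq_matI) auto
  then show ?thesis using U by (simp add: Y_mat_def Let_def)
qed

lemma orthonormal_Y:
  assumes "orthonormal d U"
  shows "orthonormal (2 * d) (Y_mat d U)"
  using orthonormal_mult[OF orthonormal_four_block[OF assms] orthonormal_Sigma] assms
  by (simp add: Y_mat_eq orthonormal_def)

text \<open>The shuffle gathers equal positions from all blocks. Entries from different blocks
  vanish, so each quarter is diagonal.\<close>

lemma Sigma_conj_block_diag:
  fixes M :: "nat \<Rightarrow> real mat"
  assumes M: "\<And>i. i < d \<Longrightarrow> M i \<in> carrier_mat 2 2"
  shows "Sigma_mat d * block_diag d M * transpose_mat (Sigma_mat d) = four_block_mat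
    (mat_diag d (\<lambda>i. M i $$ (0, 0))) (mat_diag d (\<lambda>i. M i $$ (0, 1)))
    (mat_diag d (\<lambda>i. M i $$ (1, 0))) (mat_diag d (\<lambda>i. M i $$ (1, 1)))"
proof -
  have D: "block_diag d M \<in> carrier_mat (2 * d) (2 * d)" using M by (rule block_diag_carrier)
  show ?thesis unfolding Sigma_conj[OF D]
    by (intro eq_matI) (auto simp: mat_diag_def block_diag_index[OF M] perm_pi_less perm_pi_div_mod)
qed

lemma conj_four_block_mat:
  fixes P Q :: "real mat"
  assumes c: "P \<in> carrier_mat d d" "Q \<in> carrier_mat d d"
    "A \<in> carrier_mat d d" "B \<in> carrier_mat d d" "C \<in> carrier_mat d d" "D \<in> carrier_mat d d"
  shows "four_block_mat P (0\<^sub>m d d) (0\<^sub>m d d) P * four_block_mat A B C D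
      * four_block_mat Q (0\<^sub>m d d) (0\<^sub>m d d) Q
    = four_block_mat (P * A * Q) (P * B * Q) (P * C * Q) (P * D * Q)"
proof -
  have PZ: "P * Z \<in> carrier_mat d d" if "Z \<in> carrier_mat d d" for Z using c that by auto
  have "four_block_mat P (0\<^sub>m d d) (0\<^sub>m d d) P * four_block_mat A B C D
    = four_block_mat (P * A) (P * B) (P * C) (P * D)"
    using c PZ by (simp add: mult_four_block_mat[of _ d d _ d _ d _ _ d _ d] left_mult_zero_mat[of _ d d])
  moreover have "\<dots> * four_block_mat Q (0\<^sub>m d d) (0\<^sub>m d d) Q
    = four_block_mat (P * A * Q) (P * B * Q) (P * C * Q) (P * D * Q)"
    using c PZ by (simp add: mult_four_block_mat[of _ d d _ d _ d _ _ d _ d] right_mult_zero_mat[of _ d d]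
      mult_carrier_mat[of _ d d _ d] del: assoc_mult_mat)
  ultimately show ?thesis by simp
qed

text \<open>The pattern by which \<open>A_mat\<close> and \<open>T^T T\<close> are recognized: four
  quarters, each diagonal in the eigenbasis \<open>U\<close>.\<close>

lemma Y_conj_block_diag:
  fixes M :: "nat \<Rightarrow> real mat"
  assumes U: "orthonormal d U" and M: "\<And>i. i < d \<Longrightarrow> M i \<in> carrier_mat 2 2"
  shows "Y_mat d U * block_diag d M * transpose_mat (Y_mat d U) = four_block_mat
    (U * mat_diag d (\<lambda>i. M i $$ (0, 0)) * transpose_mat U) (U * mat_diag d (\<lambda>i. M i $$ (0, 1)) * transpose_mat U)
    (U * mat_diag d (\<lambda>i. M i $$ (1, 0)) * transpose_mat U) (U * mat_diag d (\<lambda>i. M i $$ (1, 1)) * transpose_mat U)"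
proof -
  let ?V = "four_block_mat U (0\<^sub>m d d) (0\<^sub>m d d) U"
  have c: "U \<in> carrier_mat d d" "transpose_mat U \<in> carrier_mat d d" using U by (auto simp: orthonormal_def)
  have t: "transpose_mat ?V = four_block_mat (transpose_mat U) (0\<^sub>m d d) (0\<^sub>m d d) (transpose_mat U)"
    using c by (subst transpose_four_block_mat[of _ d d _ d _ d]) auto
  have D: "block_diag d M \<in> carrier_mat (2 * d) (2 * d)" using M by (rule block_diag_carrier)
  have SC: "Sigma_mat d * block_diag d M * transpose_mat (Sigma_mat d) = four_block_mat
    (mat_diag d (\<lambda>i. M i $$ (0, 0))) (mat_diag d (\<lambda>i. M i $$ (0, 1)))
    (mat_diag d (\<lambda>i. M i $$ (1, 0))) (mat_diag d (\<lambda>i. M i $$ (1, 1)))"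
    by (rule Sigma_conj_block_diag) (rule M)
  have "Y_mat d U * block_diag d M * transpose_mat (Y_mat d U)
    = ?V * (Sigma_mat d * block_diag d M * transpose_mat (Sigma_mat d)) * transpose_mat ?V"
    using carrier_matD[OF D] carrier_matD[OF c(1)] carrier_matD[OF Sigma_carrier[of d]]
    by (simp add: Y_mat_eq[OF c(1)] mat_transposes mat_mult_assoc)
  also have "\<dots> = four_block_mat
    (U * mat_diag d (\<lambda>i. M i $$ (0, 0)) * transpose_mat U) (U * mat_diag d (\<lambda>i. M i $$ (0, 1)) * transpose_mat U)
    (U * mat_diag d (\<lambda>i. M i $$ (1, 0)) * transpose_mat U) (U * mat_diag d (\<lambda>i. M i $$ (1, 1)) * transpose_mat U)"
    unfolding SC t using c by (intro conj_four_block_mat) auto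
  finally show ?thesis .
qed

section \<open>The coefficients in the new basis\<close>

lemma conj_mat_diag_linear:
  assumes U: "orthonormal d U"
  shows "a \<cdot>\<^sub>m 1\<^sub>m d + k \<cdot>\<^sub>m (U * mat_diag d f * transpose_mat U)
    = U * mat_diag d (\<lambda>i. a + k * f i) * transpose_mat U"
proof -
  have c: "U \<in> carrier_mat d d" using U by (auto simp: orthonormal_def)
  have "mat_diag d (\<lambda>i. a + k * f i) = a \<cdot>\<^sub>m 1\<^sub>m d + k \<cdot>\<^sub>m mat_diag d f"
    by (intro eq_matI) (auto simp: mat_diag_def)
  then show ?thesis using c carrier_matD[OF mat_diag_dim[of d f]] 
    by (simp add: mat_distribs mat_mult_assoc orthonormal_cancel[OF U])
qed

text \<open>Every block is an affine function of \<open>Q\<close>, constant for the lower two, hence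
  diagonal in the basis \<open>U\<close>.\<close>

lemma A_mat_eq:
  assumes U: "orthonormal d U" and Q: "Q = U * mat_diag d lam * transpose_mat U"
  shows "A_mat d \<alpha> \<beta> \<nu> Q
    = Y_mat d U * block_diag d (\<lambda>i. A_tilde \<alpha> \<beta> \<nu> (lam i)) * transpose_mat (Y_mat d U)"
proof -
  have c: "U \<in> carrier_mat d d" using U by (auto simp: orthonormal_def)
  have Qc: "Q \<in> carrier_mat d d" using c Q by auto
  have "(1 + \<beta>) \<cdot>\<^sub>m 1\<^sub>m d - (\<alpha> * (1 + \<nu>)) \<cdot>\<^sub>m Q = (1 + \<beta>) \<cdot>\<^sub>m 1\<^sub>m d + (- \<alpha> * (1 + \<nu>)) \<cdot>\<^sub>m Q"
    using Qc by (intro eq_matI) auto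
  also have "\<dots> = U * mat_diag d (\<lambda>i. (1 + \<beta>) + (- \<alpha> * (1 + \<nu>)) * lam i) * transpose_mat U"
    unfolding Q by (rule conj_mat_diag_linear[OF U])
  finally have b1: "(1 + \<beta>) \<cdot>\<^sub>m 1\<^sub>m d - (\<alpha> * (1 + \<nu>)) \<cdot>\<^sub>m Q
    = U * mat_diag d (\<lambda>i. (1 + \<beta>) + (- \<alpha> * (1 + \<nu>)) * lam i) * transpose_mat U" .
  have b2: "(- \<beta>) \<cdot>\<^sub>m 1\<^sub>m d + (\<alpha> * \<nu>) \<cdot>\<^sub>m Q = U * mat_diag d (\<lambda>i. - \<beta> + (\<alpha> * \<nu>) * lam i) * transpose_mat U"
    unfolding Q by (rule conj_mat_diag_linear[OF U])
  have b3: "1\<^sub>m d = U * mat_diag d (\<lambda>i. 1) * transpose_mat U"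
    using c orthonormal_cancel(2)[OF U] by simp
  have "mat_diag d (\<lambda>i. 0) = (0\<^sub>m d d :: real mat)" by (intro eq_matI) (auto simp: mat_diag_def)
  then have b4: "0\<^sub>m d d = U * mat_diag d (\<lambda>i. 0) * transpose_mat U"
    using c by (simp add: left_mult_zero_mat[of _ d d] right_mult_zero_mat[of _ d d])
  have "A_mat d \<alpha> \<beta> \<nu> Q = four_block_mat
    (U * mat_diag d (\<lambda>i. A_tilde \<alpha> \<beta> \<nu> (lam i) $$ (0, 0)) * transpose_mat U)
    (U * mat_diag d (\<lambda>i. A_tilde \<alpha> \<beta> \<nu> (lam i) $$ (0, 1)) * transpose_mat U)
    (U * mat_diag d (\<lambda>i. A_tilde \<alpha> \<beta> \<nu> (lam i) $$ (1, 0)) * transpose_mat U)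
    (U * mat_diag d (\<lambda>i. A_tilde \<alpha> \<beta> \<nu> (lam i) $$ (1, 1)) * transpose_mat U)"
    unfolding A_mat_def b1 b2 using b3 b4 by (simp add: A_tilde_def mat_of_rows_list_def)
  also have "\<dots> = Y_mat d U * block_diag d (\<lambda>i. A_tilde \<alpha> \<beta> \<nu> (lam i)) * transpose_mat (Y_mat d U)"
    by (rule Y_conj_block_diag[symmetric]) (rule U tilde_carrier)+
  finally show ?thesis .
qed

text \<open>Nonnegativity lets \<open>sqrt (lam i)\<close> square to \<open>lam i\<close>, and the
  two factors \<open>1 / sqrt 2\<close> produce the half in \<open>S_tilde\<close>.\<close>

lemma T_mat_eq:
  assumes U: "orthonormal d U" and lam: "\<And>i. i < d \<Longrightarrow> 0 \<le> lam i"
  shows "transpose_mat (T_mat d U lam) * T_mat d U lam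
    = Y_mat d U * block_diag d (\<lambda>i. S_tilde (lam i)) * transpose_mat (Y_mat d U)"
proof -
  have c: "U \<in> carrier_mat d d" using U by (auto simp: orthonormal_def)
  define L where "L = mat_diag d (\<lambda>i. sqrt (lam i))"
  have L: "L \<in> carrier_mat d d" by (simp add: L_def)
  have Lt: "transpose_mat L = L" by (intro eq_matI) (auto simp: L_def mat_diag_def)
  have LL: "(1 / 2) \<cdot>\<^sub>m (L * L) = mat_diag d (\<lambda>i. lam i / 2)"
    unfolding L_def mat_diag_diag by (intro eq_matI) (auto simp: mat_diag_def lam)
  let ?T = "(1 / sqrt 2) \<cdot>\<^sub>m (L * transpose_mat U)"
  have "transpose_mat ?T * ?T = (1 / 2) \<cdot>\<^sub>m (U * (L * L) * transpose_mat U)"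
    using carrier_matD[OF c] carrier_matD[OF L]
    by (simp add: mat_transposes mat_distribs mat_mult_assoc Lt) (intro eq_matI; simp)
  also have "\<dots> = U * mat_diag d (\<lambda>i. lam i / 2) * transpose_mat U"
    using carrier_matD[OF c] carrier_matD[OF L] unfolding LL[symmetric]
    by (simp add: mat_distribs mat_mult_assoc)
  finally have TT: "transpose_mat ?T * ?T = U * mat_diag d (\<lambda>i. lam i / 2) * transpose_mat U" .
  have "mat_diag d (\<lambda>i. 0) = (0\<^sub>m d d :: real mat)" by (intro eq_matI) (auto simp: mat_diag_def)
  then have z: "U * mat_diag d (\<lambda>i. 0) * transpose_mat U = 0\<^sub>m d d"
    using c by (simp add: left_mult_zero_mat[of _ d d] right_mult_zero_mat[of _ d d])
  have T: "?T \<in> carrier_mat d d" using L c by auto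
  have "transpose_mat (T_mat d U lam) * T_mat d U lam
    = four_block_mat (transpose_mat ?T) (0\<^sub>m d 0) (0\<^sub>m d d) (0\<^sub>m d 0) * four_block_mat ?T (0\<^sub>m d d) (0\<^sub>m 0 d) (0\<^sub>m 0 d)"
    unfolding T_mat_def L_def[symmetric]
    using T by (subst transpose_four_block_mat[of _ d d _ d _ 0]) auto
  also have "\<dots> = four_block_mat (transpose_mat ?T * ?T) (0\<^sub>m d d) (0\<^sub>m d d) (0\<^sub>m d d)"
    using T by (simp add: mult_four_block_mat[of _ d d _ 0 _ d _ _ d _ d] left_mult_zero_mat[of _ d d]
      right_mult_zero_mat[of _ d d] mult_carrier_mat[of _ d d _ d] del: assoc_mult_mat)
  also have "\<dots> = four_block_mat
    (U * mat_diag d (\<lambda>i. S_tilde (lam i) $$ (0, 0)) * transpose_mat U)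
    (U * mat_diag d (\<lambda>i. S_tilde (lam i) $$ (0, 1)) * transpose_mat U)
    (U * mat_diag d (\<lambda>i. S_tilde (lam i) $$ (1, 0)) * transpose_mat U)
    (U * mat_diag d (\<lambda>i. S_tilde (lam i) $$ (1, 1)) * transpose_mat U)"
    unfolding TT using z by (simp add: S_tilde_def mat_of_rows_list_def)
  also have "\<dots> = Y_mat d U * block_diag d (\<lambda>i. S_tilde (lam i)) * transpose_mat (Y_mat d U)"
    by (rule Y_conj_block_diag[symmetric]) (rule U tilde_carrier)+
  finally show ?thesis .
qed

lemma B_mat_carrier: "B_mat d \<alpha> \<in> carrier_mat (2 * d) d"
  by (auto simp: B_mat_def append_rows_def)

text \<open>The input space has dimension \<open>d\<close>, so the right factor is
  \<open>transpose_mat U\<close>; it takes the place of \<open>W\<close> in the orthonormal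
  transport.\<close>

lemma B_mat_eq:
  assumes U: "orthonormal d U"
  shows "B_mat d \<alpha> = Y_mat d U * block_diag d (\<lambda>i. B_tilde \<alpha>) * transpose_mat U"
proof -
  have c: "U \<in> carrier_mat d d" using U by (auto simp: orthonormal_def)
  let ?V = "four_block_mat U (0\<^sub>m d d) (0\<^sub>m d d) U"
  have D: "block_diag d (\<lambda>i. B_tilde \<alpha>) \<in> carrier_mat (2 * d) d"
    using block_diag_carrier[of d "\<lambda>i. B_tilde \<alpha>" 2 1] tilde_carrier(2) by simp
  \<comment> \<open>Entrywise form of \<open>B_mat\<close>, and also of the shuffled direct sum of
    the columns \<open>B_tilde\<close>.\<close>
  define E where "E = mat (2 * d) d (\<lambda>(i, j). if i = j then - \<alpha> else 0)"
  have BI: "block_diag d (\<lambda>i. B_tilde \<alpha>) $$ (i, j) =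
      (if i div 2 = j then B_tilde \<alpha> $$ (i mod 2, 0) else 0)" if "i < 2 * d" "j < d" for i j
    using block_diag_index[of d "\<lambda>i. B_tilde \<alpha>" 2 1 i j] tilde_carrier(2) that by simp
  have BT: "B_tilde \<alpha> $$ (0, 0) = - \<alpha>" "B_tilde \<alpha> $$ (Suc 0, 0) = 0"
    by (auto simp: B_tilde_def mat_of_rows_list_def)
  have SD: "Sigma_mat d * block_diag d (\<lambda>i. B_tilde \<alpha>) = E"
    unfolding Sigma_mult[OF D] E_def
    by (intro eq_matI) (auto simp: BI BT perm_pi_less perm_pi_div_mod)
  have BE: "B_mat d \<alpha> = E"
    by (intro eq_matI) (auto simp: E_def B_mat_def append_rows_def)
  \<comment> \<open>Both products have \<open>- \<alpha> U\<close> on top and zeros below, so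
    \<open>U\<close> passes from the input side to the state side.\<close>
  have "(E * U) $$ (i, j) = (?V * E) $$ (i, j)" if "i < 2 * d" "j < d" for i j
  proof -
    have "(E * U) $$ (i, j) = (\<Sum>k = 0..<d. (if i = k then - \<alpha> else 0) * U $$ (k, j))"
      using that c by (simp add: E_def scalar_prod_def)
    also have "\<dots> = (\<Sum>k = 0..<d. if i = k then - \<alpha> * U $$ (k, j) else 0)"
      by (intro sum.cong) auto
    finally have EU: "(E * U) $$ (i, j) = (\<Sum>k = 0..<d. if i = k then - \<alpha> * U $$ (k, j) else 0)" .
    have "(?V * E) $$ (i, j) = (\<Sum>k = 0..<2 * d. ?V $$ (i, k) * (if k = j then - \<alpha> else 0))"
      using that c by (simp add: E_def scalar_prod_def del: index_mat_four_block(1))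
    also have "\<dots> = (\<Sum>k = 0..<2 * d. if k = j then - \<alpha> * ?V $$ (i, k) else 0)"
      by (intro sum.cong) auto
    finally show ?thesis using EU that c by simp
  qed
  then have "E * U = ?V * E"
    using c by (intro eq_matI) (auto simp: E_def)
  then have eq: "B_mat d \<alpha> * U = ?V * (Sigma_mat d * block_diag d (\<lambda>i. B_tilde \<alpha>))"
    by (simp add: SD BE)
  have "B_mat d \<alpha> = B_mat d \<alpha> * U * transpose_mat U"
    using carrier_matD[OF c] carrier_matD[OF B_mat_carrier[of d \<alpha>]] right_mult_one_mat[OF B_mat_carrier]
    by (simp add: mat_mult_assoc orthonormal_cancel[OF U])
  also have "\<dots> = Y_mat d U * block_diag d (\<lambda>i. B_tilde \<alpha>) * transpose_mat U"
    unfolding eq using carrier_matD[OF c] carrier_matD[OF D] carrier_matD[OF Sigma_carrier[of d]]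
    by (simp add: Y_mat_eq[OF c] mat_mult_assoc)
  finally show ?thesis .
qed

section \<open>Positivity, the norm bound and the conclusion\<close>

text \<open>The quadratic form is tested on column \<open>i\<close> of \<open>U\<close>, a unit
  eigenvector, where its value is \<open>lam i\<close>.\<close>

lemma pos_def_eigenvalues:
  assumes Q: "pos_def d Q" and U: "orthonormal d U" and eq: "Q = U * mat_diag d lam * transpose_mat U"
    and i: "i < d"
  shows "0 < lam i"
proof -
  have c: "U \<in> carrier_mat d d" using U by (auto simp: orthonormal_def)
  let ?v = "U *\<^sub>v unit_vec d i"
  have v: "?v \<in> carrier_vec d" using c by auto
  have Uv: "transpose_mat U *\<^sub>v ?v = unit_vec d i"
    using c orthonormal_cancel(1)[OF U] by (subst assoc_mult_mat_vec[symmetric, of _ d d _ d]) auto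
  have "?v \<noteq> 0\<^sub>v d"
  proof
    assume "?v = 0\<^sub>v d"
    moreover have "transpose_mat U *\<^sub>v 0\<^sub>v d = 0\<^sub>v d" using c by (intro eq_vecI) auto
    ultimately have "unit_vec d i = (0\<^sub>v d :: real vec)" using Uv by simp
    then show False using i by (metis index_unit_vec(2) index_zero_vec(1) zero_neq_one)
  qed
  then have "0 < ?v \<bullet> (Q *\<^sub>v ?v)" using Q v by (auto simp: pos_def_def)
  also have "Q *\<^sub>v ?v = U *\<^sub>v (mat_diag d lam *\<^sub>v unit_vec d i)"
    unfolding eq using c v Uv by (simp add: assoc_mult_mat_vec[of _ d d _ d])
  also have "mat_diag d lam *\<^sub>v unit_vec d i = lam i \<cdot>\<^sub>v unit_vec d i"
    using i by (intro eq_vecI) (auto simp: mat_diag_def)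
  also have "?v \<bullet> (U *\<^sub>v (lam i \<cdot>\<^sub>v unit_vec d i)) = lam i * (?v \<bullet> ?v)"
    using c v by (simp add: mult_mat_vec[of _ d d])
  also have "?v \<bullet> ?v = 1"
    using c v Uv i transpose_vec_mult_scalar[OF c, of "unit_vec d i" ?v] by simp
  finally show ?thesis by simp
qed

text \<open>Each quotient is at most the maximum in \<open>H_inf\<close>; squaring and
  \<open>\<gamma>^2 = d / \<theta>\<close> give the strict bound that the spectral factorization
  requires.\<close>

lemma H_inf_bound:
  assumes d: "0 < d" and \<theta>: "0 < \<theta>" and \<alpha>: "0 < \<alpha>" and \<gamma>: "\<gamma> = 1 / sqrt (\<theta> / real d)"
    and H: "sqrt \<theta> * H_inf d \<alpha> \<beta> \<nu> lam < sqrt (real d)"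
    and i: "i < d" and l: "0 \<le> lam i" and s: "0 < s_tilde \<alpha> \<beta> \<nu> (lam i)"
  shows "\<alpha>\<^sup>2 * lam i / (2 * \<gamma>\<^sup>2) < (s_tilde \<alpha> \<beta> \<nu> (lam i))\<^sup>2"
proof -
  let ?s = "s_tilde \<alpha> \<beta> \<nu> (lam i)"
  have "sqrt (lam i) / ?s \<le> Max ((\<lambda>i. sqrt (lam i) / s_tilde \<alpha> \<beta> \<nu> (lam i)) ` {..<d})"
    using i by (intro Max_ge) auto
  then have "sqrt \<theta> * (\<alpha> / sqrt 2 * (sqrt (lam i) / ?s)) \<le> sqrt \<theta> * H_inf d \<alpha> \<beta> \<nu> lam"
    unfolding H_inf_def using \<alpha> \<theta> by (intro mult_left_mono) auto
  then have "sqrt \<theta> * (\<alpha> / sqrt 2 * (sqrt (lam i) / ?s)) < sqrt (real d)" using H by linarith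
  then have "(sqrt \<theta> * (\<alpha> / sqrt 2 * (sqrt (lam i) / ?s)))\<^sup>2 < (sqrt (real d))\<^sup>2"
    using \<alpha> \<theta> l s by (intro power_strict_mono) auto
  then have "\<theta> * (\<alpha>\<^sup>2 / 2 * (lam i / ?s\<^sup>2)) < real d"
    using \<theta> l by (simp add: power_mult_distrib power_divide)
  then have "\<alpha>\<^sup>2 * lam i / (2 * (real d / \<theta>)) < ?s\<^sup>2"
    using s \<theta> d by (simp add: field_simps)
  moreover have "\<gamma>\<^sup>2 = real d / \<theta>" using \<theta> d by (simp add: \<gamma> power_divide)
  ultimately show ?thesis by simp
qed

text \<open>The two unique-existence conjuncts keep the final implication from being
  vacuous.\<close>

theorem lemmaB2:
  fixes d :: nat
    and Q U :: "real mat"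
    and lam :: "nat \<Rightarrow> real"
    and \<alpha> \<beta> \<nu> \<theta> \<gamma> :: real
  assumes "0 < d"
    and "pos_def d Q"
    and "orthonormal d U"
    and "Q = U * mat_diag d lam * transpose_mat U"
    and "\<And>i j. i \<le> j \<Longrightarrow> j < d \<Longrightarrow> lam i \<le> lam j"
    and "lam 0 < lam (d - 1)"
    and "0 < \<alpha>" and "0 \<le> \<beta>" and "0 \<le> \<nu>"
    and "rho (A_mat d \<alpha> \<beta> \<nu> Q) < 1"
    and "0 < \<theta>"
    and "sqrt \<theta> * H_inf d \<alpha> \<beta> \<nu> lam < sqrt (real d)"
    and "\<gamma> = 1 / sqrt (\<theta> / real d)"
  shows "orthonormal (2 * d) (Y_mat d U)
    \<and> (\<forall>i<d. \<exists>!X. stabilizing_2x2 \<alpha> \<beta> \<nu> (lam i) \<gamma> X)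
    \<and> (\<exists>!X. stabilizing_full d \<alpha> \<beta> \<nu> Q U lam \<gamma> X)
    \<and> (\<forall>X Xt. stabilizing_full d \<alpha> \<beta> \<nu> Q U lam \<gamma> X \<longrightarrow>
          (\<forall>i<d. stabilizing_2x2 \<alpha> \<beta> \<nu> (lam i) \<gamma> (Xt i)) \<longrightarrow>
          X = Y_mat d U * diag_block_mat (map Xt [0..<d]) * transpose_mat (Y_mat d U))"
proof -
  let ?Y = "Y_mat d U"
  let ?A = "\<lambda>i. A_tilde \<alpha> \<beta> \<nu> (lam i)" and ?B = "\<lambda>i::nat. B_tilde \<alpha>" and ?S = "\<lambda>i. S_tilde (lam i)"
  note d = assms(1) and U = assms(3)
  have lam: "0 < lam i" if "i < d" for i
    using pos_def_eigenvalues[OF assms(2-4) that] .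
  have \<gamma>: "0 < \<gamma>" using assms by simp
  have Y: "orthonormal (2 * d) ?Y" by (rule orthonormal_Y[OF U])
  have A_eq: "A_mat d \<alpha> \<beta> \<nu> Q = ?Y * block_diag d ?A * transpose_mat ?Y"
    by (rule A_mat_eq[OF U assms(4)])
  have B_eq: "B_mat d \<alpha> = ?Y * block_diag d ?B * transpose_mat U"
    by (rule B_mat_eq[OF U])
  have S_eq: "transpose_mat (T_mat d U lam) * T_mat d U lam = ?Y * block_diag d ?S * transpose_mat ?Y"
    using lam by (intro T_mat_eq[OF U]) (simp add: less_imp_le)
  have D: "block_diag d ?A \<in> carrier_mat (2 * d) (2 * d)" "block_diag d ?B \<in> carrier_mat (2 * d) d"
    "block_diag d ?S \<in> carrier_mat (2 * d) (2 * d)"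
    using block_diag_carrier[of d ?A 2 2] block_diag_carrier[of d ?B 2 1] block_diag_carrier[of d ?S 2 2]
      tilde_carrier by simp_all
  \<comment> \<open>Stability of the full system descends to every two-by-two system.\<close>
  have "rho (block_diag d ?A) < 1"
    using assms(10) rho_conj_orthonormal[OF Y D(1)] d unfolding A_eq by simp
  then have rho_A: "rho (?A i) < 1" if "i < d" for i
    using rho_block_diag[of d ?A 2] tilde_carrier(1) d that by simp
  have ex: "\<exists>X. stabilizing_2x2 \<alpha> \<beta> \<nu> (lam i) \<gamma> X" if i: "i < d" for i
  proof (rule stabilizing_2x2_exists[OF \<gamma> assms(7) lam[OF i] rho_A[OF i]])
    have "0 < s_tilde \<alpha> \<beta> \<nu> (lam i)"
      using rho_A[OF i] s_tilde_bound(1) unfolding rho_A_tilde by blast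
    then show "\<alpha>\<^sup>2 * lam i / (2 * \<gamma>\<^sup>2) < (s_tilde \<alpha> \<beta> \<nu> (lam i))\<^sup>2"
      using lam[OF i] H_inf_bound[OF d assms(11,7,13,12) i] by simp
  qed
  have unique2: "X = Z" if "stabilizing_2x2 \<alpha> \<beta> \<nu> l \<gamma> X" "stabilizing_2x2 \<alpha> \<beta> \<nu> l \<gamma> Z" for l X Z
  proof -
    interpret riccati_data 2 1 "A_tilde \<alpha> \<beta> \<nu> l" "B_tilde \<alpha>" "S_tilde l" \<gamma>
      using tilde_carrier transpose_S_tilde \<gamma> by unfold_locales auto
    show ?thesis using that stabilizing_solution_unique unfolding stabilizing_2x2_def by auto
  qed
  have unique: "X = Z" if "stabilizing_full d \<alpha> \<beta> \<nu> Q U lam \<gamma> X" "stabilizing_full d \<alpha> \<beta> \<nu> Q U lam \<gamma> Z" for X Z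
  proof -
    have c: "U \<in> carrier_mat d d" "?Y \<in> carrier_mat (2 * d) (2 * d)"
      using U Y by (auto simp: orthonormal_def)
    have T: "T_mat d U lam \<in> carrier_mat d (2 * d)"
      using c by (intro carrier_matI) (auto simp: T_mat_def mat_diag_def)
    interpret riccati_data "2 * d" d "A_mat d \<alpha> \<beta> \<nu> Q" "B_mat d \<alpha>" "transpose_mat (T_mat d U lam) * T_mat d U lam" \<gamma>
    proof
      show "A_mat d \<alpha> \<beta> \<nu> Q \<in> carrier_mat (2 * d) (2 * d)" unfolding A_eq using c D(1) by auto
      show "transpose_mat (transpose_mat (T_mat d U lam) * T_mat d U lam) = transpose_mat (T_mat d U lam) * T_mat d U lam"
        using T by (simp add: mat_transposes)
    qed (use B_mat_carrier T \<gamma> in auto)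
    show ?thesis using that stabilizing_solution_unique d unfolding stabilizing_full_def by auto
  qed
  have full: "stabilizing_full d \<alpha> \<beta> \<nu> Q U lam \<gamma> (?Y * block_diag d Xt * transpose_mat ?Y)"
    if Xt: "\<forall>i<d. stabilizing_2x2 \<alpha> \<beta> \<nu> (lam i) \<gamma> (Xt i)" for Xt
  proof -
    \<comment> \<open>The transport lemma is used in block coordinates, with \<open>?Y\<close> for
      the state and \<open>U\<close> for the input.\<close>
    interpret riccati_data "2 * d" d "block_diag d ?A" "block_diag d ?B" "block_diag d ?S" \<gamma>
      using D \<gamma> transpose_S_tilde by unfold_locales (auto simp: block_diag_transpose)
    have "stabilizing_solution (2 * d) (1 * d) (block_diag d ?A) (block_diag d ?B) (block_diag d ?S) \<gamma> (block_diag d Xt)"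
      using Xt tilde_carrier d by (intro stabilizing_solution_block_diag) (auto simp: stabilizing_2x2_def)
    then show ?thesis
      unfolding stabilizing_full_def A_eq B_eq S_eq
      using stabilizing_solution_orthonormal[OF Y U] d by simp
  qed
  obtain Xt where Xt: "\<forall>i<d. stabilizing_2x2 \<alpha> \<beta> \<nu> (lam i) \<gamma> (Xt i)"
    using ex by metis
  have "\<exists>!X. stabilizing_full d \<alpha> \<beta> \<nu> Q U lam \<gamma> X"
    using full[OF Xt] unique by blast
  moreover have "\<forall>i<d. \<exists>!X. stabilizing_2x2 \<alpha> \<beta> \<nu> (lam i) \<gamma> X"
    using ex unique2 by blast
  ultimately show ?thesis
    using Y unique full unfolding block_diag_def by blast
qed

end
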